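(* Let $p$ and $\frac{p+1}{2}$ both be odd primes. Then, as polynomials in $z$, $$2(1+z)\,c_{{\rm d}\backslash{\rm u}}(p,z)=c_{{\rm d}\backslash{\rm u}}(p+1,z).$$
   Context: All graphs are simple (no loops, no multiple edges or arcs). An undirected edge is identified with the pair of oppositely directed arcs, so undirected graphs are regarded as symmetric digraphs. A circulant of order $n$ is a digraph on the vertex set $\mathbb{Z}_n=\{0,1,\dots,n-1\}$ invariant under the cyclic permutation $v\mapsto v+1 \pmod n$; it is regular of some valency $r$ (each vertex has out-degree and in-degree $r$). $C_{{\rm d}\backslash{\rm u}}(n,r)$ denotes the number of isomorphism classes of directed circulants of order $n$ and valency $r$ that are not undirected graphs (i.e. whose arc set is not symmetric), and $c_{{\rm d}\backslash{\rm u}}(n,z)=\sum_{r\ge 0}C_{{\rm d}\backslash{\rm u}}(n,r)z^r$. *)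

theory Defs
  imports
    "Graph_Theory.Pair_Digraph"
    "Graph_Theory.Digraph_Isomorphism"
    "HOL-Computational_Algebra.Polynomial"
    "HOL-Computational_Algebra.Primes"
begin

text \<open>The vertex set \<open>\<int>\<^sub>n\<close> is represented by the residues \<open>{0..<n}\<close>. The locale
  \<^locale>\<open>pair_digraph\<close> excludes loops, and arcs are pairs, so there are no parallel arcs.\<close>

definition circulant :: "nat \<Rightarrow> nat pair_pre_digraph \<Rightarrow> bool" where
  "circulant n G \<longleftrightarrow> pair_digraph G \<and> pverts G = {0..<n} \<and>
     map_prod (\<lambda>v. (v + 1) mod n) (\<lambda>v. (v + 1) mod n) ` parcs G = parcs G"

definition regular_of_valency :: "('a, 'b) pre_digraph \<Rightarrow> nat \<Rightarrow> bool" where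
  "regular_of_valency G r \<longleftrightarrow> (\<forall>v \<in> verts G. out_degree G v = r \<and> in_degree G v = r)"

definition nonsym_circulants :: "nat \<Rightarrow> nat \<Rightarrow> nat pair_pre_digraph set" where
  "nonsym_circulants n r =
     {G. circulant n G \<and> regular_of_valency (with_proj G) r \<and> \<not> symmetric (with_proj G)}"

definition iso_on :: "'a pair_pre_digraph set \<Rightarrow> 'a pair_pre_digraph rel" where
  "iso_on S = {(G, H). G \<in> S \<and> H \<in> S \<and> digraph_iso (with_proj G) (with_proj H)}"

text \<open>The library notion of isomorphism maps arcs separately from vertices; for digraphs whose
  arcs are pairs it is the usual one.\<close>

lemma digraph_iso_with_proj_iff:
  assumes "pair_digraph G"
  shows "digraph_iso (with_proj G) (with_proj H) \<longleftrightarrow>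
    (\<exists>f. bij_betw f (pverts G) (pverts H) \<and> map_prod f f ` parcs G = parcs H)"
    (is "?L \<longleftrightarrow> ?R")
proof
  assume ?L
  then obtain h where h: "pre_digraph.digraph_isomorphism (with_proj G) h"
    and H: "with_proj H = app_iso h (with_proj G)"
    by (auto simp: digraph_iso_def)
  let ?f = "iso_verts h"
  have pv: "pverts H = ?f ` pverts G" and pa: "parcs H = iso_arcs h ` parcs G"
    and t: "iso_tail h = fst" and hd: "iso_head h = snd"
    using H by (simp_all add: with_proj_def app_iso_def)
  have "iso_arcs h a = map_prod ?f ?f a" if "a \<in> parcs G" for a
    using h that unfolding pre_digraph.digraph_isomorphism_def
    by (auto simp: t hd prod_eq_iff)
  then have "map_prod ?f ?f ` parcs G = parcs H"
    unfolding pa by (auto intro!: image_cong)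
  moreover have "bij_betw ?f (pverts G) (pverts H)"
    using h pv by (simp add: pre_digraph.digraph_isomorphism_def bij_betw_def)
  ultimately show ?R by blast
next
  assume ?R
  then obtain f where f: "bij_betw f (pverts G) (pverts H)"
    and a: "map_prod f f ` parcs G = parcs H" by blast
  interpret pair_digraph G by (rule assms)
  let ?h = "\<lparr>iso_verts = f, iso_arcs = map_prod f f, iso_head = snd, iso_tail = fst\<rparr>"
  have inj: "inj_on f (pverts G)" using f by (rule bij_betw_imp_inj_on)
  have "parcs G \<subseteq> pverts G \<times> pverts G" using in_arcsD1 in_arcsD2 by auto
  then have "inj_on (map_prod f f) (parcs G)"
    using map_prod_inj_on[OF inj inj] by (rule inj_on_subset[rotated])
  then have "pre_digraph.digraph_isomorphism (with_proj G) ?h"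
    using inj wf_digraph by (simp add: pre_digraph.digraph_isomorphism_def)
  moreover have "with_proj H = app_iso ?h (with_proj G)"
    using f a by (simp add: with_proj_def app_iso_def bij_betw_def)
  ultimately show ?L unfolding digraph_iso_def by blast
qed

definition C_du :: "nat \<Rightarrow> nat \<Rightarrow> nat" where
  "C_du n r = card (nonsym_circulants n r // iso_on (nonsym_circulants n r))"

text \<open>Summing over \<open>r < n\<close> loses nothing: \<open>coeff_c_du\<close> below covers every \<open>r\<close>.\<close>

definition c_du :: "nat \<Rightarrow> int poly" where
  "c_du n = (\<Sum>r<n. monom (int (C_du n r)) r)"

lemma nonsym_circulants_eq_empty:
  assumes "n \<le> r"
  shows "nonsym_circulants n r = {}"
proof (rule ccontr)
  assume "nonsym_circulants n r \<noteq> {}"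
  then obtain G where circ: "circulant n G" and reg: "regular_of_valency (with_proj G) r"
    and nsym: "\<not> symmetric (with_proj G)"
    by (auto simp: nonsym_circulants_def)
  interpret pair_digraph G using circ by (simp add: circulant_def)
  have V: "pverts G = {0..<n}" using circ by (simp add: circulant_def)
  have "parcs G \<noteq> {}" using nsym by (auto simp: symmetric_def sym_def)
  then obtain u v where "(u, v) \<in> parcs G" by auto
  then have u: "u \<in> pverts G" by (rule in_arcsD1)
  have "out_arcs (with_proj G) u \<subseteq> Pair u ` (pverts G - {u})"
    using in_arcsD2 pair_no_loops by (fastforce simp: out_arcs_def)
  then have "out_degree (with_proj G) u \<le> card (Pair u ` (pverts G - {u}))"
    unfolding out_degree_def by (intro card_mono) (auto simp: V)
  also have "\<dots> \<le> card (pverts G - {u})" by (rule card_image_le) (simp add: V)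
  also have "\<dots> < n" using u by (simp add: V)
  finally have "out_degree (with_proj G) u < n" .
  moreover have "out_degree (with_proj G) u = r"
    using reg u by (simp add: regular_of_valency_def)
  ultimately show False using assms by simp
qed

lemma coeff_c_du: "coeff (c_du n) r = int (C_du n r)"
  by (auto simp: c_du_def coeff_sum C_du_def nonsym_circulants_eq_empty)

end

theory Submission
  imports Defs "HOL-Number_Theory.Residue_Primitive_Roots" "HOL-Combinatorics.Permutations"
begin

text \<open>
  For \<open>n = p\<close> and for \<open>n = 2 * q\<close>, where \<open>q = (p + 1) div 2\<close>, two circulants of order \<open>n\<close> are isomorphic
  only if a unit of \<open>\<int>\<^sub>n\<close> multiplies the connection set of one to that of the other
  (\<open>cay_iso_prime\<close>, \<open>cay_iso_double_prime\<close>). Both sides of the identity therefore count orbits of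
  unit groups on those connection sets \<open>S\<close> with \<open>-S \<noteq> S\<close>.

  Put \<open>m = q - 1\<close>, so that \<open>p - 1 = 2 * m\<close>. The units modulo \<open>p\<close> form a cyclic group of order \<open>2 * m\<close>
  acting regularly on the nonzero residues. The units modulo \<open>2 * q\<close> form a cyclic group of order \<open>m\<close>;
  it fixes the residue \<open>q\<close>, whose free choice gives the factor \<open>1 + z\<close>, and has two regular orbits on
  the other nonzero residues, just like the subgroup of index two of the first group. In both cases
  \<open>-1\<close> is the unique element of order two, and it lies in that subgroup because \<open>m\<close> is even. It remains
  to see that every orbit of the large group on asymmetric sets splits into exactly two orbits of the
  subgroup (\<open>card_even_shift_classes\<close>). This holds because an element outside the subgroup has
  \<open>-1\<close> as its \<open>m\<close>-th power and hence fixes no asymmetric set.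

  The isomorphism property is obtained by counting. The rotations by multiples of \<open>t\<close> (with \<open>t = 1\<close>
  for a prime order and \<open>t = 2\<close> for order \<open>2 * q\<close>) form a group of prime order, which acts from the left
  and from the right on the set of all isomorphisms between two circulants. All orbits of this joint
  action have size the square of that prime, except those of isomorphisms normalising the rotation
  group, which are affine. Counting modulo the square shows that if any isomorphism exists then an
  affine one does (\<open>affine_cay_iso_exists\<close>). For order \<open>2 * q\<close> this argument breaks down when the odd
  part of the connection set is empty or contains all odd residues; the digraph or its complement then
  consists of two copies of a circulant of order \<open>q\<close>, and the prime case applies.
\<close>

section \<open>Isomorphisms between Cayley digraphs of cyclic groups\<close>

text \<open>The element \<open>y - x\<close> of \<open>\<int>\<^sub>n\<close>, computed over \<open>int\<close> because subtraction on \<open>nat\<close> truncates.\<close>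
definition offset :: "nat \<Rightarrow> nat \<Rightarrow> nat \<Rightarrow> nat" where
  "offset n x y = nat ((int y - int x) mod int n)"

lemma int_offset: "n > 0 \<Longrightarrow> int (offset n x y) = (int y - int x) mod int n"
  by (simp add: offset_def)

lemma offset_less: "n > 0 \<Longrightarrow> offset n x y < n"
  unfolding offset_def by (simp add: nat_less_iff)

lemma offset_affine:
  assumes "n > 0"
  shows "offset n ((u * x + b) mod n) ((u * y + b) mod n) = (u * offset n x y) mod n"
proof -
  have "int (offset n ((u * x + b) mod n) ((u * y + b) mod n)) = (int u * (int y - int x)) mod int n"
    using assms by (simp add: int_offset zmod_int mod_diff_eq algebra_simps)
  also have "\<dots> = int ((u * offset n x y) mod n)"
    using assms by (simp add: int_offset zmod_int mod_mult_right_eq)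
  finally show ?thesis by simp
qed

lemma offset_add:
  assumes "n > 0"
  shows "offset n ((x + b) mod n) ((y + b) mod n) = offset n x y"
  using offset_affine[OF assms, of 1 x b y] offset_less[OF assms] by simp

lemma offset_plus:
  assumes "s < n"
  shows "offset n x ((x + s) mod n) = s"
proof -
  have "int (offset n x ((x + s) mod n)) = int s"
    using assms by (simp add: int_offset zmod_int mod_diff_left_eq)
  then show ?thesis by simp
qed

lemma plus_offset:
  assumes "y < n"
  shows "(x + offset n x y) mod n = y"
proof -
  have "int ((x + offset n x y) mod n) = int y"
    using assms by (simp add: int_offset zmod_int mod_add_right_eq)
  then show ?thesis by simp
qed

lemma offset_eq_0_iff:
  assumes "x < n" "y < n"
  shows "offset n x y = 0 \<longleftrightarrow> x = y"
  using plus_offset[OF assms(2), of x] assms by (auto simp: offset_def)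

lemma offset_zero_left: "s < n \<Longrightarrow> offset n 0 s = s"
  using offset_plus[of s n 0] by simp

definition rot :: "nat \<Rightarrow> nat \<Rightarrow> nat \<Rightarrow> nat" where
  "rot n k x = (if x < n then (x + k) mod n else x)"

lemma rot_comp: "rot n a \<circ> rot n b = rot n (a + b)"
  by (auto simp: rot_def fun_eq_iff mod_simps ac_simps)

lemma rot_mod: "rot n (a mod n) = rot n a"
  by (auto simp: rot_def fun_eq_iff mod_simps)

lemma rot_multiple: "rot n (n * k) = id"
  by (auto simp: rot_def fun_eq_iff)

lemma rot_0: "rot n 0 = id"
  by (auto simp: rot_def fun_eq_iff)

lemma rot_eq_id_dvd: "rot n a = id \<Longrightarrow> n > 0 \<Longrightarrow> n dvd a"
  by (drule fun_cong[where x = 0]) (auto simp: rot_def)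

definition mult_set :: "nat \<Rightarrow> nat \<Rightarrow> nat set \<Rightarrow> nat set" where
  "mult_set n u S = (\<lambda>s. u * s mod n) ` S"

lemma mult_set_cong:
  assumes "[u = v] (mod n)"
  shows "mult_set n u S = mult_set n v S"
  using assms unfolding mult_set_def cong_def by (metis mod_mult_left_eq)

lemma mult_set_1:
  assumes "S \<subseteq> {..<n}"
  shows "mult_set n 1 S = S"
proof -
  have "mult_set n 1 S = (\<lambda>s. s) ` S"
    unfolding mult_set_def using assms by (intro image_cong) auto
  then show ?thesis by simp
qed

lemma mult_set_mult_set: "mult_set n u (mult_set n v S) = mult_set n (u * v) S"
  by (simp add: mult_set_def image_image mod_mult_right_eq mult.assoc)

lemma mult_set_inverse:
  assumes "coprime u n" "S \<subseteq> {..<n}"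
  obtains v where "coprime v n" "mult_set n v (mult_set n u S) = S"
proof -
  obtain v where v: "[u * v = 1] (mod n)" using cong_solve_coprime_nat[OF assms(1)] by auto
  then have "coprime v n" using coprime_iff_invertible_nat by (metis mult.commute One_nat_def)
  moreover have "mult_set n v (mult_set n u S) = S"
    using mult_set_cong[OF v] mult_set_1[OF assms(2)] by (simp add: mult_set_mult_set mult.commute)
  ultimately show thesis by (rule that)
qed

lemma inj_on_mult_mod:
  fixes n u :: nat
  assumes "coprime u n"
  shows "inj_on (\<lambda>s. u * s mod n) {..<n}"
proof (rule inj_onI)
  fix x y assume xy: "x \<in> {..<n}" "y \<in> {..<n}" "u * x mod n = u * y mod n"
  then have "[x = y] (mod n)"
    using assms by (metis cong_def cong_mult_lcancel_nat coprime_commute)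
  then show "x = y" using xy by (simp add: cong_def)
qed

lemma mult_mod_in_mult_set:
  assumes "coprime u n" "S \<subseteq> {..<n}" "s < n"
  shows "u * s mod n \<in> mult_set n u S \<longleftrightarrow> s \<in> S"
  using inj_on_image_mem_iff[OF inj_on_mult_mod[OF assms(1)], of s S] assms
  by (auto simp: mult_set_def)

text \<open>Like \<open>rot\<close>, this map is the identity outside \<open>{..<n}\<close>, so that it is a permutation in the
  sense of \<open>permutes\<close> and equality of maps can be tested with \<open>=\<close>.\<close>
definition aff :: "nat \<Rightarrow> nat \<Rightarrow> nat \<Rightarrow> nat \<Rightarrow> nat" where
  "aff n u b x = (if x < n then (u * x + b) mod n else x)"

lemma aff_permutes:
  assumes "coprime u n"
  shows "aff n u b permutes {..<n}"
proof (rule inj_imp_permutes)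
  show "inj_on (aff n u b) {..<n}"
  proof (rule inj_onI)
    fix x y assume xy: "x \<in> {..<n}" "y \<in> {..<n}" "aff n u b x = aff n u b y"
    then have "[u * x + b = u * y + b] (mod n)" by (simp add: aff_def cong_def)
    then have "[u * x = u * y] (mod n)" by (simp add: cong_add_rcancel_nat)
    then show "x = y" using inj_onD[OF inj_on_mult_mod[OF assms], of x y] xy(1,2) by (simp add: cong_def)
  qed
qed (auto simp: aff_def)

lemma rot_permutes: "rot n a permutes {..<n}"
proof -
  have "rot n a = aff n 1 a" by (auto simp: rot_def aff_def fun_eq_iff)
  then show ?thesis using aff_permutes[OF coprime_1_left] by metis
qed

text \<open>The isomorphisms between the Cayley digraphs of \<open>\<int>\<^sub>n\<close> with connection sets \<open>S\<close> and \<open>S'\<close>: the arcs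
  are the pairs whose offset lies in the connection set.\<close>
definition cay_iso :: "nat \<Rightarrow> nat set \<Rightarrow> nat set \<Rightarrow> (nat \<Rightarrow> nat) set" where
  "cay_iso n S S' = {f. f permutes {..<n} \<and>
     (\<forall>x<n. \<forall>y<n. offset n (f x) (f y) \<in> S' \<longleftrightarrow> offset n x y \<in> S)}"

lemma cay_iso_less: "f \<in> cay_iso n S S' \<Longrightarrow> x < n \<Longrightarrow> f x < n"
  using permutes_in_image[of f "{..<n}" x] by (simp add: cay_iso_def)

lemma finite_cay_iso: "finite (cay_iso n S S')"
  using finite_permutations[of "{..<n}"] by (auto simp: cay_iso_def intro: finite_subset[rotated])

lemma cay_iso_comp:
  assumes "f \<in> cay_iso n S S'" "g \<in> cay_iso n S' S''"
  shows "g \<circ> f \<in> cay_iso n S S''"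
  using assms cay_iso_less[OF assms(1)] by (auto simp: cay_iso_def permutes_compose)

lemma cay_iso_inv:
  assumes "f \<in> cay_iso n S S'"
  shows "inv_into UNIV f \<in> cay_iso n S' S"
proof -
  have p: "f permutes {..<n}" using assms by (simp add: cay_iso_def)
  then have ip: "inv_into UNIV f permutes {..<n}" by (rule permutes_inv)
  have "offset n (inv_into UNIV f x) (inv_into UNIV f y) \<in> S \<longleftrightarrow> offset n x y \<in> S'" if "x < n" "y < n" for x y
  proof -
    have "inv_into UNIV f x < n" "inv_into UNIV f y < n"
      using that permutes_in_image[OF ip] by auto
    then show ?thesis
      using assms permutes_inverses(1)[OF p] by (force simp: cay_iso_def)
  qed
  then show ?thesis using ip by (simp add: cay_iso_def)
qed

lemma card_cay_iso:
  assumes f: "f \<in> cay_iso n S S'"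
  shows "card (cay_iso n S S') = card (cay_iso n S S)"
proof -
  have p: "f permutes {..<n}" using assms by (simp add: cay_iso_def)
  have "bij_betw (\<lambda>g. f \<circ> g) (cay_iso n S S) (cay_iso n S S')"
  proof (rule bij_betwI[where g = "\<lambda>g. inv_into UNIV f \<circ> g"])
    show "(\<circ>) f \<in> cay_iso n S S \<rightarrow> cay_iso n S S'"
      using cay_iso_comp f by blast
    show "(\<circ>) (inv_into UNIV f) \<in> cay_iso n S S' \<rightarrow> cay_iso n S S"
      using cay_iso_comp cay_iso_inv[OF f] by blast
  qed (simp_all add: comp_assoc[symmetric] permutes_inv_o[OF p])
  then show ?thesis by (simp add: bij_betw_same_card)
qed

lemma rot_in_cay_iso: "rot n a \<in> cay_iso n S S"
  using rot_permutes by (auto simp: cay_iso_def rot_def offset_add)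

section \<open>Counting isomorphisms modulo \<open>q\<^sup>2\<close>\<close>

text \<open>The isomorphisms that conjugate the group generated by \<open>rot n t\<close> into itself. In the two cases
  that matter they will turn out to be affine.\<close>
definition intertwiners :: "nat \<Rightarrow> nat \<Rightarrow> nat set \<Rightarrow> nat set \<Rightarrow> (nat \<Rightarrow> nat) set" where
  "intertwiners n t S S' =
     {f \<in> cay_iso n S S'. \<exists>k. f \<circ> rot n t = rot n (t * k) \<circ> f}"

lemma intertwine_multiple:
  assumes "f \<circ> rot n a = rot n b \<circ> f"
  shows "f \<circ> rot n (c * a) = rot n (c * b) \<circ> f"
proof (induction c)
  case (Suc c)
  have "f \<circ> rot n (Suc c * a) = (f \<circ> rot n a) \<circ> rot n (c * a)"
    by (simp add: rot_comp comp_assoc)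
  also have "\<dots> = rot n b \<circ> (f \<circ> rot n (c * a))" by (simp add: assms comp_assoc)
  also have "\<dots> = (rot n b \<circ> rot n (c * b)) \<circ> f" by (simp only: Suc.IH comp_assoc)
  also have "\<dots> = rot n (Suc c * b) \<circ> f" by (simp add: rot_comp)
  finally show ?case .
qed (simp add: rot_0)

text \<open>The action of the square of the group of order \<open>q = n div t\<close> generated by \<open>rot n t\<close>, on the two
  sides of an isomorphism.\<close>
definition twist :: "nat \<Rightarrow> nat \<Rightarrow> nat \<Rightarrow> nat \<Rightarrow> (nat \<Rightarrow> nat) \<Rightarrow> nat \<Rightarrow> nat" where
  "twist n t i j f = rot n (t * i) \<circ> f \<circ> rot n (t * j)"

lemma twist_in_cay_iso: "f \<in> cay_iso n S S' \<Longrightarrow> twist n t i j f \<in> cay_iso n S S'"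
  unfolding twist_def by (intro cay_iso_comp[of _ _ S S] cay_iso_comp[of _ _ S S'] rot_in_cay_iso)

lemma twist_twist: "twist n t i j (twist n t i' j' f) = twist n t (i + i') (j + j') f"
proof -
  have "twist n t i j (twist n t i' j' f) =
      (rot n (t * i) \<circ> rot n (t * i')) \<circ> f \<circ> (rot n (t * j') \<circ> rot n (t * j))"
    by (simp add: twist_def comp_assoc)
  then show ?thesis by (simp add: rot_comp twist_def algebra_simps)
qed

lemma twist_mod:
  assumes "n = t * q"
  shows "twist n t (i mod q) (j mod q) f = twist n t i j f"
  unfolding twist_def
  by (metis assms rot_mod mult_mod_right)

lemma twist_untwist:
  assumes "n = t * q" "q > 0"
  shows "twist n t ((q - 1) * i) ((q - 1) * j) (twist n t i j f) = f"
proof -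
  have "(q - 1) * i + i = q * i" for i using assms by (cases q) auto
  then have "twist n t ((q - 1) * i) ((q - 1) * j) (twist n t i j f) = twist n t (q * i) (q * j) f"
    by (simp only: twist_twist)
  also have "\<dots> = rot n (n * i) \<circ> f \<circ> rot n (n * j)"
    by (simp only: twist_def assms(1) mult.assoc)
  finally show ?thesis by (simp add: rot_multiple)
qed

lemma twist_intertwiners:
  assumes "f \<in> intertwiners n t S S'"
  shows "twist n t i j f \<in> intertwiners n t S S'"
proof -
  obtain k where k: "f \<circ> rot n t = rot n (t * k) \<circ> f"
    using assms by (auto simp: intertwiners_def)
  have "twist n t i j f \<circ> rot n t = rot n (t * i) \<circ> (f \<circ> rot n t) \<circ> rot n (t * j)"
    by (simp add: twist_def comp_assoc rot_comp add.commute)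
  also have "\<dots> = (rot n (t * i) \<circ> rot n (t * k)) \<circ> f \<circ> rot n (t * j)"
    by (simp only: k comp_assoc)
  also have "\<dots> = (rot n (t * k) \<circ> rot n (t * i)) \<circ> f \<circ> rot n (t * j)"
    by (simp only: rot_comp add.commute)
  also have "\<dots> = rot n (t * k) \<circ> twist n t i j f" by (simp only: twist_def comp_assoc)
  finally show ?thesis
    using assms twist_in_cay_iso by (auto simp: intertwiners_def)
qed

text \<open>Since the actions on either side are free, a nontrivial stabiliser contains an element which is
  nontrivial on both sides; as \<open>q\<close> is prime, a power of it expresses that \<open>f\<close> intertwines the generator
  \<open>rot n t\<close> with some power of itself. Hence the isomorphisms that are not
  intertwiners have regular orbits.\<close>
lemma inj_on_twist:
  assumes "prime q" "n = t * q" "t > 0" 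
    and f: "f \<in> cay_iso n S S'" "f \<notin> intertwiners n t S S'"
  shows "inj_on (\<lambda>(i, j). twist n t i j f) ({..<q} \<times> {..<q})"
proof (rule inj_onI, clarsimp)
  fix i j i' j'
  assume ij: "i < q" "j < q" "i' < q" "j' < q" and eq: "twist n t i j f = twist n t i' j' f"
  have n: "n > 0" using assms prime_gt_0_nat by simp
  define a b where "a = j + (q - j')" and "b = i' + (q - i)"
  have "twist n t (q - i + i) (q - j' + j) f = twist n t (q - i + i') (q - j' + j') f"
    using arg_cong[OF eq, of "twist n t (q - i) (q - j')"] by (simp add: twist_twist)
  then have ab: "f \<circ> rot n (t * a) = rot n (t * b) \<circ> f"
    using ij rot_multiple[of n 1] by (simp add: twist_def a_def b_def add.commute flip: assms(2))
  have "j = j'"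
  proof (rule ccontr)
    assume "j \<noteq> j'"
    have "\<not> q dvd a"
    proof
      assume "q dvd a"
      then obtain k where k: "a = q * k" ..
      then have "q * k < q * 2" "q * k > 0" using ij unfolding a_def by linarith+
      then have "k = 1" by (cases k) auto
      then show False using k ij \<open>j \<noteq> j'\<close> by (simp add: a_def)
    qed
    then have "coprime a q" using assms(1) prime_imp_coprime coprime_commute by blast
    then obtain c where "[a * c = 1] (mod q)"
      using cong_solve_coprime_nat by auto
    then have c: "(c * a) mod q = 1"
      using prime_gt_1_nat[OF assms(1)] by (simp add: cong_def mult.commute)
    \<comment> \<open>\<open>c\<close> inverts \<open>a\<close> modulo \<open>q\<close>, so the \<open>c\<close>-th power of the rotation on the right is the generator\<close>
    have "rot n (c * (t * a)) = rot n (t * ((c * a) mod q))"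
      by (metis assms(2) mult.left_commute mult_mod_right rot_mod)
    then have "f \<circ> rot n t = rot n (t * (c * b)) \<circ> f"
      using intertwine_multiple[OF ab, of c] c by (simp add: mult.left_commute)
    then show False using f by (auto simp: intertwiners_def)
  qed
  moreover have "i = i'"
  proof -
    have "rot n (t * a) = id"
      using \<open>j = j'\<close> ij assms(2) rot_multiple[of n 1] by (simp add: a_def)
    then have "f = rot n (t * b) \<circ> f" using ab by simp
    moreover have "surj f"
      using f permutes_surj[of f "{..<n}"] by (simp add: cay_iso_def)
    ultimately have "rot n (t * b) = id"
      by (metis fun.map_id surj_fun_eq)
    then have "n dvd t * b" using n by (rule rot_eq_id_dvd)
    then have "q dvd b" using assms(2,3) by simp
    then obtain k where k: "b = q * k" ..
    then have "q * k < q * 2" "q * k > 0" using ij unfolding b_def by linarith+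
    then have "k = 1" by (cases k) auto
    then show ?thesis using k ij by (simp add: b_def)
  qed
  ultimately show "i = i' \<and> j = j'" by simp
qed

lemma sq_dvd_card_non_intertwiners:
  assumes "prime q" "n = t * q" "t > 0" 
  shows "q\<^sup>2 dvd card (cay_iso n S S' - intertwiners n t S S')"
proof -
  let ?X = "cay_iso n S S' - intertwiners n t S S'"
  define R where "R = {(f, g). f \<in> ?X \<and> g \<in> ?X \<and> (\<exists>i j. g = twist n t i j f)}"
  have q: "q > 0" using assms prime_gt_0_nat by blast
  have closed: "twist n t i j f \<in> ?X" if "f \<in> ?X" for f i j
    using that twist_in_cay_iso twist_untwist[OF assms(2) q] twist_intertwiners
    by (metis DiffD1 DiffD2 DiffI)
  have "equiv ?X R"
  proof (rule equivI)
    show "R \<subseteq> ?X \<times> ?X" by (auto simp: R_def)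
    show "refl_on ?X R"
    proof (rule refl_onI)
      fix f assume "f \<in> ?X"
      moreover have "f = twist n t 0 0 f" by (simp add: twist_def rot_0)
      ultimately show "(f, f) \<in> R" unfolding R_def by blast
    qed
    show "sym R"
    proof (rule symI)
      fix f g assume fg: "(f, g) \<in> R"
      then obtain i j where "g = twist n t i j f" by (auto simp: R_def)
      then have "f = twist n t ((q - 1) * i) ((q - 1) * j) g"
        using twist_untwist[OF assms(2) q] by simp
      moreover have "f \<in> ?X" "g \<in> ?X" using fg by (simp_all add: R_def)
      ultimately show "(g, f) \<in> R" unfolding R_def by blast
    qed
    show "trans R"
    proof (rule transI)
      fix f g h assume "(f, g) \<in> R" "(g, h) \<in> R"
      then show "(f, h) \<in> R" unfolding R_def using twist_twist by fastforce
    qed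
  qed
  then show ?thesis
  proof (rule equiv_imp_dvd_card[rotated])
    show "finite ?X" using finite_cay_iso by blast
    fix X assume "X \<in> ?X // R"
    then obtain f where f: "f \<in> ?X" and X: "X = R `` {f}" by (auto simp: quotient_def)
    have "X = (\<lambda>(i, j). twist n t i j f) ` ({..<q} \<times> {..<q})"
    proof
      show "X \<subseteq> (\<lambda>(i, j). twist n t i j f) ` ({..<q} \<times> {..<q})"
      proof
        fix g assume "g \<in> X"
        then obtain i j where g: "g = twist n t i j f" by (auto simp: X R_def)
        have "g = (\<lambda>(i, j). twist n t i j f) (i mod q, j mod q)"
          using twist_mod[OF assms(2)] g by simp
        then show "g \<in> (\<lambda>(i, j). twist n t i j f) ` ({..<q} \<times> {..<q})"
          by (rule image_eqI) (use q in auto)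
      qed
      show "(\<lambda>(i, j). twist n t i j f) ` ({..<q} \<times> {..<q}) \<subseteq> X"
        using closed[OF f] f by (auto simp: X R_def)
    qed
    then have "card X = q\<^sup>2"
      using inj_on_twist[OF assms, of f S S'] f by (simp add: card_image power2_eq_square)
    then show "q\<^sup>2 dvd card X" by simp
  qed
qed

lemma aff_in_intertwiners:
  assumes "coprime u n" "S \<subseteq> {..<n}"
  shows "aff n u b \<in> intertwiners n t S (mult_set n u S)"
proof -
  have "aff n u b \<in> cay_iso n S (mult_set n u S)"
    using aff_permutes[OF assms(1)]
    by (auto simp: cay_iso_def aff_def offset_affine mult_mod_in_mult_set[OF assms] offset_less)
  moreover have "aff n u b \<circ> rot n t = rot n (t * u) \<circ> aff n u b"
  proof
    fix x
    have "(u * ((x + t) mod n) + b) mod n = (u * (x + t) + b) mod n"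
      by (metis mod_add_left_eq mod_mult_right_eq)
    also have "u * (x + t) + b = u * x + b + t * u" by (simp add: algebra_simps)
    finally show "(aff n u b \<circ> rot n t) x = (rot n (t * u) \<circ> aff n u b) x"
      by (simp add: aff_def rot_def mod_add_left_eq)
  qed
  ultimately show ?thesis by (auto simp: intertwiners_def)
qed

lemma cay_iso_affine_imp_mult_set:
  assumes "f \<in> cay_iso n S S'" "coprime u n" "S \<subseteq> {..<n}" "S' \<subseteq> {..<n}"
    and f: "\<forall>x<n. f x = (u * x + b) mod n"
  shows "S' = mult_set n u S"
proof -
  have *: "u * s mod n \<in> S' \<longleftrightarrow> s \<in> S" if "s < n" for s
  proof -
    have "offset n (f 0) (f s) \<in> S' \<longleftrightarrow> offset n 0 s \<in> S"
      using assms(1) that by (auto simp: cay_iso_def)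
    then show ?thesis
      using that f offset_affine[of n u 0 b s] by (simp add: offset_zero_left)
  qed
  have bij: "(\<lambda>s. u * s mod n) ` {..<n} = {..<n}"
    by (rule endo_inj_surj) (auto simp: inj_on_mult_mod[OF assms(2)])
  show ?thesis
  proof
    show "S' \<subseteq> mult_set n u S"
    proof
      fix s assume s: "s \<in> S'"
      then have "s \<in> (\<lambda>s. u * s mod n) ` {..<n}" using bij assms(4) by auto
      then show "s \<in> mult_set n u S" using * s by (auto simp: mult_set_def)
    qed
    show "mult_set n u S \<subseteq> S'" using * assms(3) by (auto simp: mult_set_def)
  qed
qed

lemma aff_eqD:
  assumes "aff n u b = aff n v c" "n > 1" "u < n" "v < n" "b < n" "c < n"
  shows "u = v" "b = c"
proof -
  have "n > 0" using assms(2) by simp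
  then show b: "b = c" using fun_cong[OF assms(1), of 0] assms(5,6) by (simp add: aff_def)
  have "[u + b = v + b] (mod n)"
    using fun_cong[OF assms(1), of 1] assms(2) b by (simp add: aff_def cong_def)
  then have "[u = v] (mod n)" by (simp add: cong_add_rcancel_nat)
  then show "u = v" using assms by (simp add: cong_def)
qed

text \<open>The key step towards the Cayley isomorphism property. If an isomorphism exists, there are as many
  isomorphisms from \<open>S\<close> to \<open>S'\<close> as automorphisms of \<open>S\<close>. Modulo \<open>q\<^sup>2\<close> both numbers can be computed by
  counting only intertwiners, which are affine. The affine automorphisms of \<open>S\<close> number \<open>n = t * q\<close>
  times the size of a nonempty set of fewer than \<open>q\<close> units, which is not divisible by \<open>q\<^sup>2\<close>. So there is
  an affine isomorphism from \<open>S\<close> to \<open>S'\<close> as well, and its linear part carries \<open>S\<close> to \<open>S'\<close>. This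
  replaces the usual conjugation of Sylow subgroups.\<close>
lemma affine_cay_iso_exists:
  assumes q: "prime q" "n = t * q" "t > 0" "coprime t q" "totient n < q"
    and S: "S \<subseteq> {..<n}" "S' \<subseteq> {..<n}"
    and affine: "\<And>S' f. S' \<subseteq> {..<n} \<Longrightarrow> f \<in> intertwiners n t S S' \<Longrightarrow>
      \<exists>u b. coprime u n \<and> (\<forall>x<n. f x = (u * x + b) mod n)"
    and f: "f \<in> cay_iso n S S'"
  shows "\<exists>u. coprime u n \<and> S' = mult_set n u S"
proof -
  have "q \<le> t * q" using q(3) by simp
  then have n1: "n > 1" using q(2) prime_gt_1_nat[OF q(1)] by linarith
  define U where "U = {u \<in> totatives n. mult_set n u S = S}"
  have U_iff: "u \<in> U \<longleftrightarrow> u < n \<and> coprime u n \<and> mult_set n u S = S" for u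
    using n1 totatives_less[of u n] by (cases "u = 0") (auto simp: U_def in_totatives_iff)
  have bij: "bij_betw (\<lambda>(u, b). aff n u b) (U \<times> {..<n}) (intertwiners n t S S)"
    unfolding bij_betw_def
  proof
    show "inj_on (\<lambda>(u, b). aff n u b) (U \<times> {..<n})"
      using aff_eqD[OF _ n1] by (auto simp: inj_on_def U_iff)
    show "(\<lambda>(u, b). aff n u b) ` (U \<times> {..<n}) = intertwiners n t S S"
    proof
      show "(\<lambda>(u, b). aff n u b) ` (U \<times> {..<n}) \<subseteq> intertwiners n t S S"
        using aff_in_intertwiners[OF _ S(1)] by (force simp: U_iff)
      show "intertwiners n t S S \<subseteq> (\<lambda>(u, b). aff n u b) ` (U \<times> {..<n})"
      proof
        fix g assume g: "g \<in> intertwiners n t S S"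
        then obtain u b where u: "coprime u n" and ub: "\<forall>x<n. g x = (u * x + b) mod n"
          using affine S(1) by blast
        have gc: "g \<in> cay_iso n S S" using g by (simp add: intertwiners_def)
        then have gx: "g x = x" if "\<not> x < n" for x
          using that by (auto simp: cay_iso_def permutes_def)
        have um: "coprime (u mod n) n" using u n1 by simp
        have ub': "\<forall>x<n. g x = (u mod n * x + b mod n) mod n"
          using ub by (metis mod_add_eq mod_mod_trivial mod_mult_left_eq)
        then have "g = aff n (u mod n) (b mod n)" using gx by (auto simp: aff_def fun_eq_iff)
        moreover have "S = mult_set n (u mod n) S"
          using cay_iso_affine_imp_mult_set[OF gc um S(1) S(1) ub'] .
        ultimately show "g \<in> (\<lambda>(u, b). aff n u b) ` (U \<times> {..<n})"
          using um n1 by (intro image_eqI[of _ _ "(u mod n, b mod n)"]) (auto simp: U_iff)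
      qed
    qed
  qed
  have cardI: "card (intertwiners n t S S) = n * card U"
    using bij_betw_same_card[OF bij] by (simp add: card_cartesian_product mult.commute)
  have finU: "finite U" and "1 \<in> U"
    using n1 mult_set_1[OF S(1)] by (auto simp: U_def in_totatives_iff)
  have "card U \<le> totient n"
    unfolding U_def totient_def by (intro card_mono) auto
  moreover have "card U > 0" using \<open>1 \<in> U\<close> finU by (auto simp: card_gt_0_iff)
  ultimately have "\<not> q dvd card U" using q(5) by (auto dest: dvd_imp_le)
  moreover have "\<not> q dvd t"
    using q by (metis coprime_absorb_right not_prime_unit)
  ultimately have "\<not> q dvd t * card U" using q(1) prime_dvd_mult_iff by blast
  then have ndvd: "\<not> q\<^sup>2 dvd card (intertwiners n t S S)"
    using q(1,2) unfolding cardI by (simp add: power2_eq_square ac_simps prime_gt_0_nat)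
  have split: "card (cay_iso n S T) = card (cay_iso n S T - intertwiners n t S T) + card (intertwiners n t S T)" for T
    using finite_cay_iso[of n S T] by (subst card_Diff_subset)
      (auto simp: intertwiners_def card_mono intro: finite_subset)
  have "\<not> q\<^sup>2 dvd card (cay_iso n S S')"
    unfolding card_cay_iso[OF f] split[of S]
    using ndvd sq_dvd_card_non_intertwiners[OF q(1-3)] by (simp add: dvd_add_right_iff)
  then have "card (intertwiners n t S S') \<noteq> 0"
    using sq_dvd_card_non_intertwiners[OF q(1-3), of S S'] split[of S'] by (metis add_0_right)
  then obtain g where g: "g \<in> intertwiners n t S S'" by fastforce
  then obtain u b where "coprime u n" "\<forall>x<n. g x = (u * x + b) mod n"
    using affine S(2) by blast
  then show ?thesis
    using g cay_iso_affine_imp_mult_set[of g n S S' u b] S by (auto simp: intertwiners_def)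
qed

section \<open>The Cayley isomorphism property for prime order\<close>

lemma intertwiner_step:
  assumes "f \<circ> rot n t = rot n (t * k) \<circ> f" "f \<in> cay_iso n S S'" "y < n"
  shows "f ((y + t * i) mod n) = (f y + t * k * i) mod n"
proof -
  have "f (rot n (i * t) y) = rot n (i * (t * k)) (f y)"
    using fun_cong[OF intertwine_multiple[OF assms(1), of i], of y] by simp
  then show ?thesis
    using assms(3) cay_iso_less[OF assms(2,3)] by (simp add: rot_def ac_simps)
qed

lemma cay_iso_eqD:
  assumes "f \<in> cay_iso n S S'" "f x = f y"
  shows "x = y"
  using assms permutes_inj[of f "{..<n}"] by (auto simp: cay_iso_def dest: injD)

lemma intertwiner_affine_prime:
  assumes p: "prime p" and f: "f \<in> intertwiners p 1 S S'"
  shows "\<exists>u b. coprime u p \<and> (\<forall>x<p. f x = (u * x + b) mod p)"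
proof -
  from f obtain k where fc: "f \<in> cay_iso p S S'" and k: "f \<circ> rot p 1 = rot p (1 * k) \<circ> f"
    by (auto simp: intertwiners_def)
  have p1: "p > 1" using p prime_gt_1_nat by blast
  have step: "f x = (f 0 + k * x) mod p" if "x < p" for x
    using intertwiner_step[OF k fc, of 0 x] that p1 by simp
  have "\<not> p dvd k"
  proof
    assume "p dvd k"
    then have "f 1 = f 0"
      using step[of 1] p1 cay_iso_less[OF fc, of 0] by (auto elim!: dvdE)
    then show False using cay_iso_eqD[OF fc] by fastforce
  qed
  then have "coprime k p" using p prime_imp_coprime coprime_commute by blast
  then show ?thesis using step by (metis add.commute)
qed

theorem cay_iso_prime:
  assumes "prime p" "S \<subseteq> {..<p}" "S' \<subseteq> {..<p}" "f \<in> cay_iso p S S'"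
  shows "\<exists>u. coprime u p \<and> S' = mult_set p u S"
  using assms prime_gt_0_nat[OF assms(1)]
  by (intro affine_cay_iso_exists[of p p 1 S S' f] intertwiner_affine_prime)
    (auto simp: totient_prime)

section \<open>The Cayley isomorphism property for twice an odd prime\<close>

lemma coprime_double_iff:
  fixes u q :: nat
  shows "coprime u (2 * q) \<longleftrightarrow> odd u \<and> coprime u q"
  by (simp add: coprime_right_2_iff_odd)

lemma odd_representative:
  fixes k q :: nat
  assumes "odd q" "coprime k q"
  obtains u where "coprime u (2 * q)" "[u = k] (mod q)"
proof
  let ?u = "if odd k then k else k + q"
  show "[?u = k] (mod q)" by (simp add: cong_def)
  then have "coprime ?u q" using assms cong_imp_coprime cong_sym by blast
  then show "coprime ?u (2 * q)" unfolding coprime_double_iff using assms by simp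
qed

lemma solve_cong_prime:
  fixes q k c :: nat
  assumes "prime q" "\<not> q dvd k"
  obtains i where "[k * i = c] (mod q)"
proof -
  have "coprime k q" using assms prime_imp_coprime coprime_commute by blast
  then obtain j where j: "[k * j = 1] (mod q)" using cong_solve_coprime_nat by auto
  have "[k * j * c = 1 * c] (mod q)" using j by (rule cong_scalar_right)
  then show thesis using that[of "j * c"] by (simp add: mult.assoc)
qed

lemma cong_double: "[a = b] (mod q) \<Longrightarrow> [2 * a = 2 * b] (mod (2 * q))" for a b q :: nat
  by (simp add: cong_def mult_mod_right[symmetric])

lemma odd_mod_double_form:
  fixes q a :: nat
  assumes "odd q" "odd a" "a < 2 * q"
  shows "(q + 2 * ((a + q) div 2)) mod (2 * q) = a"
proof -
  have "q + 2 * ((a + q) div 2) = a + 2 * q" using assms by simp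
  then show ?thesis using assms(3) by (simp only: mod_add_self2 mod_less)
qed

text \<open>An intertwiner of \<open>rot n 2\<close> is affine on the even and on the odd residues with the same slope; only
  the constant \<open>d = f q - f 0\<close> is in question. Comparing the arcs from \<open>0\<close> to the odd residues with
  those from \<open>q\<close> to the even ones shows that the odd part of \<open>S'\<close> is invariant under translation by
  \<open>2 * d\<close>. Unless \<open>d = q\<close>, such translations act transitively on the odd residues, so the odd part of
  \<open>S\<close> would be empty or everything; the elements \<open>a\<close> and \<open>b\<close> exclude this.\<close>
lemma intertwiner_affine_double_prime:
  assumes q: "prime q" "odd q" and n: "n = 2 * q"
    and S: "a < n" "odd a" "a \<in> S" "b < n" "odd b" "b \<notin> S"
    and f: "f \<in> intertwiners n 2 S S'"
  shows "\<exists>u b. coprime u n \<and> (\<forall>x<n. f x = (u * x + b) mod n)"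
proof -
  from f obtain k where fc: "f \<in> cay_iso n S S'" and k: "f \<circ> rot n 2 = rot n (2 * k) \<circ> f"
    by (auto simp: intertwiners_def)
  have "q > 2" using q prime_ge_2_nat[OF q(1)] by (cases "q = 2") auto
  then have n2: "n > 2" "q < n" "n > 0" using n by auto
  have step: "f ((y + 2 * i) mod n) = (f y + 2 * k * i) mod n" if "y < n" for y i
    using intertwiner_step[OF k fc that] .
  have kq: "\<not> q dvd k"
  proof
    assume "q dvd k"
    then obtain c where "k = q * c" ..
    then have "2 * k * 1 = n * c" by (simp add: n)
    then have "f ((0 + 2 * 1) mod n) = f 0"
      using step[of 0 1] n2 cay_iso_less[OF fc, of 0] by (simp only: mod_mult_self2 mod_less)
    then have "(0 + 2 * 1) mod n = 0" by (rule cay_iso_eqD[OF fc])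
    then show False using n2 by simp
  qed
  define d where "d = offset n (f 0) (f q)"
  have "d < n" using n2 offset_less by (simp add: d_def)
  have fq: "f q = (f 0 + d) mod n"
    using plus_offset[of "f q" n "f 0"] cay_iso_less[OF fc n2(2)] by (simp add: d_def)
  have "odd d"
  proof
    assume "even d"
    then obtain c where c: "d = 2 * c" ..
    obtain i where "[k * i = c] (mod q)" using solve_cong_prime[OF q(1) kq] .
    then have "[2 * (k * i) = d] (mod n)" unfolding c n by (rule cong_double)
    then have "[f 0 + 2 * (k * i) = f 0 + d] (mod n)" by (rule cong_add[OF cong_refl])
    then have "f ((2 * i) mod n) = f q"
      using step[of 0 i] n2 by (simp add: fq cong_def mult.assoc)
    then have "(2 * i) mod n = q" by (rule cay_iso_eqD[OF fc])
    then have "2 * (i mod q) = q" by (simp add: n)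
    then show False using q(2) by (metis dvd_triv_left)
  qed
  have arc1: "(q + 2 * i) mod n \<in> S \<longleftrightarrow> (d + 2 * k * i) mod n \<in> S'" for i
  proof -
    have "f ((q + 2 * i) mod n) = (f 0 + (d + 2 * k * i) mod n) mod n"
      using step[OF n2(2), of i] by (simp add: fq mod_simps add.assoc)
    then have "offset n (f 0) (f ((q + 2 * i) mod n)) = (d + 2 * k * i) mod n"
      using n2 by (simp only: offset_plus mod_less_divisor)
    moreover have "offset n 0 ((q + 2 * i) mod n) = (q + 2 * i) mod n"
      using n2 by (simp add: offset_zero_left)
    moreover have "offset n (f 0) (f ((q + 2 * i) mod n)) \<in> S' \<longleftrightarrow>
        offset n 0 ((q + 2 * i) mod n) \<in> S"
      using fc n2 by (simp add: cay_iso_def)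
    ultimately show ?thesis by simp
  qed
  have arc2: "(q + 2 * i) mod n \<in> S \<longleftrightarrow> ((n - d) + 2 * k * i) mod n \<in> S'" for i
  proof -
    have "f ((2 * i) mod n) = (f 0 + 2 * k * i) mod n"
      using step[of 0 i] n2 by simp
    also have "\<dots> = (f q + ((n - d) + 2 * k * i) mod n) mod n"
    proof -
      have "(f q + ((n - d) + 2 * k * i) mod n) mod n = (f 0 + d + ((n - d) + 2 * k * i)) mod n"
        by (simp only: fq mod_add_eq mod_mod_trivial)
      also have "f 0 + d + ((n - d) + 2 * k * i) = f 0 + 2 * k * i + n" using \<open>d < n\<close> by simp
      finally show ?thesis by simp
    qed
    finally have "offset n (f q) (f ((2 * i) mod n)) = ((n - d) + 2 * k * i) mod n"
      using n2 by (simp only: offset_plus mod_less_divisor)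
    moreover have "offset n q ((2 * i) mod n) = (q + 2 * i) mod n"
    proof -
      have "(2 * i) mod n = (q + (q + 2 * i) mod n) mod n"
        by (simp add: n mod_simps flip: add.assoc mult_2)
      then show ?thesis using n2 by (simp only: offset_plus mod_less_divisor)
    qed
    moreover have "offset n (f q) (f ((2 * i) mod n)) \<in> S' \<longleftrightarrow>
        offset n q ((2 * i) mod n) \<in> S"
      using fc n2 by (simp add: cay_iso_def)
    ultimately show ?thesis by simp
  qed
  have "d = q"
  proof (rule ccontr)
    assume "d \<noteq> q"
    have qd: "\<not> q dvd d"
    proof
      assume "q dvd d"
      then obtain c where c: "d = q * c" ..
      then have "c < 2" using \<open>d < n\<close> n by (simp add: mult.commute)
      then have "c = 0 \<or> c = 1" by auto
      then show False using \<open>d \<noteq> q\<close> \<open>odd d\<close> c by auto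
    qed
    obtain j where j: "[k * j = (q - 1) * d] (mod q)" using solve_cong_prime[OF q(1) kq] .
    have "[2 * (k * j) = 2 * ((q - 1) * d)] (mod n)" using j unfolding n by (rule cong_double)
    then have "[d + 2 * k * j = d + 2 * ((q - 1) * d)] (mod n)"
      using cong_add[OF cong_refl] by (metis mult.assoc)
    moreover have "[d + 2 * ((q - 1) * d) = n - d] (mod n)"
    proof -
      have "d + 2 * ((q - 1) * d) + d = n * d"
        using \<open>q > 2\<close> by (cases q) (auto simp: n algebra_simps)
      then have "[d + 2 * ((q - 1) * d) + d = (n - d) + d] (mod n)"
        using \<open>d < n\<close> by (simp add: cong_def)
      then show ?thesis by (simp only: cong_add_rcancel_nat)
    qed
    ultimately have dj: "[d + 2 * k * j = n - d] (mod n)" by (rule cong_trans)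
    have shift: "(q + 2 * (i + j)) mod n \<in> S \<longleftrightarrow> (q + 2 * i) mod n \<in> S" for i
    proof -
      have "[d + 2 * k * j + 2 * k * i = (n - d) + 2 * k * i] (mod n)"
        using dj by (rule cong_add[OF _ cong_refl])
      then have "(d + 2 * k * (i + j)) mod n = ((n - d) + 2 * k * i) mod n"
        by (simp add: cong_def algebra_simps)
      then show ?thesis using arc1[of "i + j"] arc2[of i] by simp
    qed
    have shifts: "(q + 2 * (i + m * j)) mod n \<in> S \<longleftrightarrow> (q + 2 * i) mod n \<in> S" for i m
    proof (induction m)
      case (Suc m)
      then show ?case using shift[of "i + m * j"] by (simp add: ac_simps)
    qed simp
    have "\<not> q dvd j"
    proof
      assume "q dvd j"
      then have "q dvd k * j" by simp
      then have "q dvd (q - 1) * d" using cong_dvd_iff[OF j] by blast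
      then have "q dvd q - 1" using q(1) qd prime_dvd_mult_iff by blast
      then show False using \<open>q > 2\<close> by (auto dest: dvd_imp_le)
    qed
    \<comment> \<open>enough shifts by \<open>j\<close> lead from the position of \<open>a\<close> to that of \<open>b\<close>\<close>
    define i i' where "i = (a + q) div 2" and "i' = (b + q) div 2"
    obtain m where m: "[j * m = (q - 1) * i + i'] (mod q)"
      using solve_cong_prime[OF q(1) \<open>\<not> q dvd j\<close>] .
    have "[i + m * j = i + ((q - 1) * i + i')] (mod q)"
      using m by (intro cong_add) (simp_all add: mult.commute)
    moreover have "i + ((q - 1) * i + i') = i' + q * i"
      using \<open>q > 2\<close> by (cases q) auto
    ultimately have "[i + m * j = i' + q * i] (mod q)" by (simp only:)
    then have "[i + m * j = i'] (mod q)" by (simp add: cong_def)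
    then have "[2 * (i + m * j) = 2 * i'] (mod n)" unfolding n by (rule cong_double)
    then have "[q + 2 * (i + m * j) = q + 2 * i'] (mod n)" by (rule cong_add[OF cong_refl])
    moreover have "(q + 2 * i) mod n = a" "(q + 2 * i') mod n = b"
      using odd_mod_double_form[OF q(2)] S by (auto simp: i_def i'_def n)
    ultimately show False using shifts[of i m] S by (simp add: cong_def)
  qed
  have "coprime k q" using q(1) kq prime_imp_coprime coprime_commute by blast
  then obtain u where u: "coprime u n" "[u = k] (mod q)"
    using odd_representative[OF q(2)] unfolding n by blast
  have uk: "[2 * k * i = 2 * u * i] (mod n)" for i
  proof -
    have "[k * i = u * i] (mod q)" using u(2) by (intro cong_mult) (auto simp: cong_sym)
    then show ?thesis using cong_double[of "k * i" "u * i" q] by (simp add: n mult.assoc)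
  qed
  have "f x = (u * x + f 0) mod n" if x: "x < n" for x
  proof (cases "even x")
    case True
    then obtain i where i: "x = 2 * i" ..
    have "[f 0 + 2 * k * i = f 0 + 2 * u * i] (mod n)" using uk by (rule cong_add[OF cong_refl])
    then show ?thesis using step[of 0 i] n2 x by (simp add: i cong_def ac_simps)
  next
    case False
    define i where "i = (x + q) div 2"
    have xi: "(q + 2 * i) mod n = x"
      using odd_mod_double_form[OF q(2) False] x by (simp add: i_def n)
    have "odd u" using u(1) by (simp add: n)
    then obtain c where "u = 2 * c + 1" by (rule oddE)
    then have uq: "[q = u * q] (mod n)" by (simp add: cong_def n algebra_simps)
    have "[f 0 + q + 2 * k * i = f 0 + u * q + 2 * u * i] (mod n)"
      by (intro cong_add uk uq cong_refl)
    also have "f 0 + u * q + 2 * u * i = u * (q + 2 * i) + f 0" by (simp add: algebra_simps)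
    finally have "(f 0 + q + 2 * k * i) mod n = (u * (q + 2 * i) + f 0) mod n"
      by (simp add: cong_def)
    moreover have "(u * (q + 2 * i) + f 0) mod n = (u * x + f 0) mod n"
      using xi by (metis mod_add_left_eq mod_mult_right_eq)
    moreover have "f x = (f 0 + q + 2 * k * i) mod n"
      using step[OF n2(2), of i] by (simp add: xi fq \<open>d = q\<close> mod_simps)
    ultimately show ?thesis by simp
  qed
  then show ?thesis using u(1) by blast
qed

lemma cay_iso_double_prime_mixed:
  assumes q: "prime q" "odd q" and n: "n = 2 * q"
    and S: "S \<subseteq> {..<n}" "S' \<subseteq> {..<n}"
    and ab: "a < n" "odd a" "a \<in> S" "b < n" "odd b" "b \<notin> S"
    and f: "f \<in> cay_iso n S S'"
  shows "\<exists>u. coprime u n \<and> S' = mult_set n u S"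
proof (rule affine_cay_iso_exists[OF q(1) n _ _ _ S _ f])
  show "coprime 2 q" using q(2) by simp
  show "totient n < q"
    using q prime_gt_1_nat[OF q(1)] by (simp add: n totient_double totient_prime)
qed (use intertwiner_affine_double_prime[OF q n ab] in auto)

lemma offset_double:
  assumes "q > 0"
  shows "offset (2 * q) (2 * x + c) (2 * y + c) = 2 * offset q x y"
proof -
  have "int (offset (2 * q) (2 * x + c) (2 * y + c)) = (2 * (int y - int x)) mod (2 * int q)"
    using assms by (simp add: int_offset)
  also have "\<dots> = int (2 * offset q x y)"
    unfolding mod_mult_mult1 using assms by (simp add: int_offset)
  finally have "int (offset (2 * q) (2 * x + c) (2 * y + c)) = int (2 * offset q x y)" .
  then show ?thesis by simp
qed

text \<open>If all arcs join residues of equal parity, the digraph consists of two copies of a Cayley digraph of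
  \<open>\<int>\<^sub>q\<close>. Any nonzero \<open>e\<close> in \<open>S\<close> generates the even residues, so following its arcs shows that \<open>f\<close>
  maps the even residues into one parity class. Halving gives an isomorphism over \<open>\<int>\<^sub>q\<close>, to which the prime
  case applies; the multiplier found there is lifted to an odd one.\<close>
lemma cay_iso_double_prime_even:
  assumes q: "prime q" "odd q" and n: "n = 2 * q"
    and S: "S \<subseteq> {..<n}" "S' \<subseteq> {..<n}" "\<forall>s\<in>S. even s" "\<forall>s\<in>S'. even s"
    and f: "f \<in> cay_iso n S S'"
  shows "\<exists>u. coprime u n \<and> S' = mult_set n u S"
proof -
  have q0: "q > 0" using q prime_gt_0_nat by blast
  then have n0: "n > 0" by (simp add: n)
  have arc: "offset n (f x) (f y) \<in> S' \<longleftrightarrow> offset n x y \<in> S" if "x < n" "y < n" for x y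
    using f that by (simp add: cay_iso_def)
  show ?thesis
  proof (cases "S \<subseteq> {0}")
    case True
    have "S' = S"
    proof -
      have "s \<in> S' \<longleftrightarrow> s \<in> S" if "s < n" for s
      proof -
        define g where "g = inv_into UNIV f"
        have g: "g \<in> cay_iso n S' S" using cay_iso_inv[OF f] by (simp add: g_def)
        have gs: "offset n (g 0) (g s) \<in> S \<longleftrightarrow> s \<in> S'"
          using g that n0 by (simp add: cay_iso_def offset_zero_left)
        have "offset n (g 0) (g s) = 0 \<longleftrightarrow> s = 0"
          using cay_iso_eqD[OF g, of 0 s] cay_iso_less[OF g] that n0
          by (auto simp: offset_eq_0_iff)
        then show ?thesis using gs True by (metis insertE empty_iff subsetD)
      qed
      then show ?thesis using S by blast
    qed
    then show ?thesis using mult_set_1[OF S(1)] by (metis coprime_1_left)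
  next
    case False
    then obtain e where e: "e \<in> S" "e \<noteq> 0" by auto
    then obtain e' where e': "e = 2 * e'" using S(3) by (auto elim: evenE)
    have en: "e < n" using e S by auto
    have "\<not> q dvd e'" using e e' en n by (auto dest: dvd_imp_le)
    have par1: "even (f ((x + e) mod n)) = even (f x)" if x: "x < n" for x
    proof -
      let ?y = "(x + e) mod n"
      have y: "?y < n" using n0 by simp
      have "offset n (f x) (f ?y) \<in> S'"
        using arc[OF x y] e en by (simp add: offset_plus)
      then have "even (offset n (f x) (f ?y))" using S by blast
      moreover have "f ?y = (f x + offset n (f x) (f ?y)) mod n"
        using plus_offset[OF cay_iso_less[OF f y]] by simp
      ultimately show ?thesis
        by (metis n dvd_mod_iff dvd_triv_left even_add)
    qed
    have par: "even (f ((e * m) mod n)) = even (f 0)" for m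
    proof (induction m)
      case (Suc m)
      have "(e * Suc m) mod n = ((e * m) mod n + e) mod n"
        by (simp add: mod_simps add.commute)
      then show ?case using Suc par1[of "(e * m) mod n"] n0 by simp
    qed simp
    have parity: "f (2 * i) mod 2 = f 0 mod 2" if "i < q" for i
    proof -
      obtain m where "[e' * m = i] (mod q)" using solve_cong_prime[OF q(1) \<open>\<not> q dvd e'\<close>] .
      then have "[2 * (e' * m) = 2 * i] (mod n)" unfolding n by (rule cong_double)
      then have "(e * m) mod n = 2 * i" using that by (simp add: e' n cong_def mult.assoc)
      then have "even (f (2 * i)) = even (f 0)" using par[of m] by simp
      then show ?thesis by (metis even_iff_mod_2_eq_zero odd_iff_mod_2_eq_one)
    qed
    define g where "g i = (if i < q then f (2 * i) div 2 else i)" for i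
    have fg: "f (2 * i) = 2 * g i + f 0 mod 2" if "i < q" for i
      using parity[OF that] that by (simp add: g_def) (metis mult_div_mod_eq)
    have "g permutes {..<q}"
    proof (rule inj_imp_permutes)
      show "inj_on g {..<q}"
      proof (rule inj_onI)
        fix x y assume "x \<in> {..<q}" "y \<in> {..<q}" "g x = g y"
        then have "f (2 * x) = f (2 * y)" using fg by simp
        then show "x = y" using cay_iso_eqD[OF f] by fastforce
      qed
      show "g x \<in> {..<q}" if "x \<in> {..<q}" for x
        using that cay_iso_less[OF f, of "2 * x"] by (auto simp: g_def n)
    qed (auto simp: g_def)
    moreover have "2 * offset q (g x) (g y) \<in> S' \<longleftrightarrow> 2 * offset q x y \<in> S"
      if "x < q" "y < q" for x y
    proof -
      have "offset n (f (2 * x)) (f (2 * y)) = 2 * offset q (g x) (g y)"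
        using fg that by (simp add: n offset_double[OF q0])
      moreover have "offset n (2 * x) (2 * y) = 2 * offset q x y"
        using offset_double[OF q0, of x 0 y] by (simp add: n)
      ultimately show ?thesis using arc[of "2 * x" "2 * y"] that by (simp add: n)
    qed
    ultimately have "g \<in> cay_iso q {s. 2 * s \<in> S} {s. 2 * s \<in> S'}"
      by (simp add: cay_iso_def)
    moreover have "{s. 2 * s \<in> T} \<subseteq> {..<q}" if "T \<subseteq> {..<n}" for T
    proof
      fix s assume "s \<in> {s. 2 * s \<in> T}"
      then have "2 * s \<in> {..<n}" using that by blast
      then show "s \<in> {..<q}" by (simp add: n)
    qed
    ultimately obtain v where v: "coprime v q" "{s. 2 * s \<in> S'} = mult_set q v {s. 2 * s \<in> S}"
      using cay_iso_prime[OF q(1)] S(1,2) by metis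
    obtain u where u: "coprime u n" "[u = v] (mod q)"
      using odd_representative[OF q(2) v(1)] unfolding n by blast
    have double: "T = (\<lambda>s. 2 * s) ` {s. 2 * s \<in> T}" if "\<forall>s\<in>T. even s" for T :: "nat set"
      using that by (auto elim!: evenE)
    have "S' = (\<lambda>s. 2 * s) ` mult_set q u {s. 2 * s \<in> S}"
      using double[OF S(4)] v(2) mult_set_cong[OF u(2)] by simp
    also have "\<dots> = mult_set n u ((\<lambda>s. 2 * s) ` {s. 2 * s \<in> S})"
      by (simp add: mult_set_def image_image n mult.left_commute)
    also have "(\<lambda>s. 2 * s) ` {s. 2 * s \<in> S} = S" using double[OF S(3)] by simp
    finally show ?thesis using u(1) by blast
  qed
qed

text \<open>By cardinality, when neither connection set has a mixed odd part the two odd parts are both empty or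
  both full, and passing to complements exchanges these two cases.\<close>
theorem cay_iso_double_prime:
  assumes q: "prime q" "odd q" and n: "n = 2 * q"
    and S: "S \<subseteq> {1..<n}" "S' \<subseteq> {1..<n}" "card S = card S'"
    and f: "f \<in> cay_iso n S S'"
  shows "\<exists>u. coprime u n \<and> S' = mult_set n u S"
proof -
  have Sn: "S \<subseteq> {..<n}" "S' \<subseteq> {..<n}" using S by auto
  define mixed where "mixed T \<longleftrightarrow> (\<exists>a b. a < n \<and> odd a \<and> a \<in> T \<and> b < n \<and> odd b \<and> b \<notin> T)" for T :: "nat set"
  define evens where "evens T \<longleftrightarrow> (\<forall>s\<in>T. even s)" for T :: "nat set"
  define full where "full T \<longleftrightarrow> {s. s < n \<and> odd s} \<subseteq> T" for T :: "nat set"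
  have trichotomy: "mixed T \<or> evens T \<or> full T" if "T \<subseteq> {..<n}" for T
    using that by (auto simp: mixed_def evens_def full_def)
  have no_mix: False if T: "evens T" "T \<subseteq> {1..<n}" and T': "full T'" "T' \<subseteq> {1..<n}"
    and c: "card T = card T'" for T T'
  proof -
    have "T \<subseteq> (\<lambda>i. 2 * i) ` {1..<q}"
    proof
      fix s assume s: "s \<in> T"
      then obtain i where "s = 2 * i" using T(1) by (auto simp: evens_def elim: evenE)
      then show "s \<in> (\<lambda>i. 2 * i) ` {1..<q}" using T(2) s by (force simp: n)
    qed
    then have "card T \<le> card ((\<lambda>i. 2 * i) ` {1..<q})" by (intro card_mono) auto
    also have "\<dots> \<le> q - 1" using card_image_le[of "{1..<q}" "\<lambda>i. 2 * i"] by simp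
    finally have "card T \<le> q - 1" .
    moreover have "(\<lambda>i. 2 * i + 1) ` {..<q} \<subseteq> T'" using T'(1) by (auto simp: full_def n)
    then have "card ((\<lambda>i. 2 * i + 1) ` {..<q}) \<le> card T'"
      using T'(2) by (intro card_mono) (auto intro: finite_subset)
    then have "q \<le> card T'" by (simp add: card_image inj_on_def)
    ultimately show False using c prime_gt_0_nat[OF q(1)] by linarith
  qed
  consider "mixed S" | "mixed S'" | "evens S" "evens S'" | "full S" "full S'"
    using trichotomy[OF Sn(1)] trichotomy[OF Sn(2)] no_mix S by metis
  then show ?thesis
  proof cases
    case 1
    then show ?thesis
      using cay_iso_double_prime_mixed[OF q n Sn _ _ _ _ _ _ f] by (auto simp: mixed_def)
  next
    case 2
    then obtain u where u: "coprime u n" "S = mult_set n u S'"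
      using cay_iso_double_prime_mixed[OF q n Sn(2,1) _ _ _ _ _ _ cay_iso_inv[OF f]]
      by (auto simp: mixed_def)
    then show ?thesis using mult_set_inverse[OF u(1) Sn(2)] by metis
  next
    case 3
    then show ?thesis
      using cay_iso_double_prime_even[OF q n Sn _ _ f] by (simp add: evens_def)
  next
    case 4
    have n0: "n > 0" using prime_gt_0_nat[OF q(1)] by (simp add: n)
    have fc: "f \<in> cay_iso n ({..<n} - S) ({..<n} - S')"
      using f offset_less[OF n0] by (auto simp: cay_iso_def)
    have ev: "\<forall>s\<in>{..<n} - S. even s" "\<forall>s\<in>{..<n} - S'. even s" 
      using 4 by (auto simp: full_def)
    obtain u where u: "coprime u n" "{..<n} - S' = mult_set n u ({..<n} - S)"
      using cay_iso_double_prime_even[OF q n _ _ ev fc] by auto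
    have "mult_set n u {..<n} = {..<n}" unfolding mult_set_def
      by (rule endo_inj_surj) (use inj_on_mult_mod[OF u(1)] in auto)
    then have "{..<n} - S' = {..<n} - mult_set n u S"
      using u(2) inj_on_image_set_diff[OF inj_on_mult_mod[OF u(1)], of "{..<n}" S] Sn
      by (simp add: mult_set_def)
    moreover have "mult_set n u S \<subseteq> {..<n}" using n0 by (auto simp: mult_set_def)
    ultimately have "S' = mult_set n u S" using Sn by blast
    then show ?thesis using u(1) by blast
  qed
qed

section \<open>Counting equivalence classes\<close>

lemma card_quotient_bij:
  assumes bij: "bij_betw F A B" and sub: "E \<subseteq> A \<times> A" "R \<subseteq> B \<times> B"
    and iff: "\<And>x y. x \<in> A \<Longrightarrow> y \<in> A \<Longrightarrow> (F x, F y) \<in> R \<longleftrightarrow> (x, y) \<in> E"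
  shows "card (A // E) = card (B // R)"
proof -
  have B: "B = F ` A" and inj: "inj_on F A" using bij by (auto simp: bij_betw_def)
  have cls: "F ` (E `` {x}) = R `` {F x}" if "x \<in> A" for x
    using that sub iff[OF that] unfolding B by blast
  have "bij_betw (image F) (A // E) (B // R)"
    unfolding bij_betw_def
  proof
    show "inj_on (image F) (A // E)"
      using sub by (intro inj_on_subset[OF inj_on_image_Pow[OF inj]]) (auto simp: quotient_def)
    show "image F ` (A // E) = B // R"
      unfolding quotient_def B using cls by auto
  qed
  then show ?thesis by (rule bij_betw_same_card)
qed

lemma card_quotient_split:
  assumes "finite A" "refl_on A R" "R \<subseteq> A \<times> A"
    and inv: "\<And>x y. (x, y) \<in> R \<Longrightarrow> P x \<longleftrightarrow> P y"
  shows "card (A // R) =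
    card ({x \<in> A. P x} // (R \<inter> {x \<in> A. P x} \<times> {x \<in> A. P x})) +
    card ({x \<in> A. \<not> P x} // (R \<inter> {x \<in> A. \<not> P x} \<times> {x \<in> A. \<not> P x}))"
    (is "_ = card (?B // ?RB) + card (?C // ?RC)")
proof -
  have B: "?RB `` {x} = R `` {x}" if "x \<in> ?B" for x using that inv assms(3) by auto
  have C: "?RC `` {x} = R `` {x}" if "x \<in> ?C" for x using that inv assms(3) by auto
  have "A // R = (?B // ?RB) \<union> (?C // ?RC)"
    unfolding quotient_def using B C by auto
  moreover have "(?B // ?RB) \<inter> (?C // ?RC) = {}"
  proof -
    have "X \<noteq> Y" if "X \<in> ?B // ?RB" "Y \<in> ?C // ?RC" for X Y
    proof -
      from that(1) obtain x where "x \<in> ?B" "X = ?RB `` {x}" by (auto elim!: quotientE)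
      then have "x \<in> X" using assms(2) by (auto simp: refl_on_def)
      moreover have "Y \<subseteq> ?C" using that(2) by (auto simp: quotient_def)
      ultimately show ?thesis using \<open>x \<in> ?B\<close> by blast
    qed
    then show ?thesis by blast
  qed
  moreover have "finite (?B // ?RB)" "finite (?C // ?RC)"
    using assms(1) by (auto intro!: finite_quotient)
  ultimately show ?thesis by (simp add: card_Un_disjoint)
qed

text \<open>Every class of \<open>R\<close> splits into the \<open>E\<close>-classes of \<open>x\<close> and of \<open>s x\<close>, for any \<open>x\<close> in it.\<close>
lemma card_quotient_index_two:
  assumes fin: "finite A" and E: "equiv A E" and R: "equiv A R" and sub: "E \<subseteq> R"
    and s: "\<And>x. x \<in> A \<Longrightarrow> (x, s x) \<in> R \<and> (x, s x) \<notin> E"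
    and cover: "\<And>x y. (x, y) \<in> R \<Longrightarrow> (x, y) \<in> E \<or> (s x, y) \<in> E"
  shows "card (A // E) = 2 * card (A // R)"
proof -
  define halves where "halves C = (\<lambda>x. E `` {x}) ` C" for C
  have RA: "R \<subseteq> A \<times> A" using R by (simp add: equiv_def)
  have two: "card (halves C) = 2" if "C \<in> A // R" for C
  proof -
    from that obtain x where x: "x \<in> A" "C = R `` {x}" by (auto elim!: quotientE)
    have sx: "s x \<in> C" "x \<in> C" using s[OF x(1)] x equiv_class_self[OF R] by auto
    have "halves C = {E `` {x}, E `` {s x}}"
    proof
      show "halves C \<subseteq> {E `` {x}, E `` {s x}}"
        unfolding halves_def x using cover equiv_class_eq[OF E] by fastforce
      show "{E `` {x}, E `` {s x}} \<subseteq> halves C" using sx by (auto simp: halves_def)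
    qed
    moreover have "E `` {x} \<noteq> E `` {s x}"
      using s[OF x(1)] RA eq_equiv_class[OF _ E] by blast
    ultimately show ?thesis by simp
  qed
  have disj: "halves C \<inter> halves D = {}" if "C \<in> A // R" "D \<in> A // R" "C \<noteq> D" for C D
  proof -
    have "E `` {x} \<noteq> E `` {y}" if "x \<in> C" "y \<in> D" for x y
    proof
      assume eq: "E `` {x} = E `` {y}"
      have "y \<in> A" using \<open>D \<in> A // R\<close> that RA by (auto simp: quotient_def)
      then have "(x, y) \<in> R" using eq_equiv_class[OF eq E] sub by blast
      then show False
        using quotient_eq_iff[OF R \<open>C \<in> A // R\<close> \<open>D \<in> A // R\<close> that] \<open>C \<noteq> D\<close> by simp
    qed
    then show ?thesis by (auto simp: halves_def)
  qed
  have "A // E = (\<Union>C \<in> A // R. halves C)"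
    using Union_quotient[OF R] by (auto simp: quotient_def[of A E] halves_def)
  then have "card (A // E) = (\<Sum>C \<in> A // R. card (halves C))"
    using finite_quotient[OF fin RA] two disj
    by (simp add: card_UN_disjoint card_ge_0_finite)
  also have "\<dots> = 2 * card (A // R)" using two by simp
  finally show ?thesis .
qed

section \<open>Sets of exponents up to shifts\<close>

definition shift_set :: "nat \<Rightarrow> nat \<Rightarrow> nat set \<Rightarrow> nat set" where
  "shift_set M k T = (\<lambda>i. (i + k) mod M) ` T"

lemma shift_set_shift_set: "shift_set M k (shift_set M l T) = shift_set M (k + l) T"
  by (simp add: shift_set_def image_image mod_simps ac_simps)

lemma shift_set_cong: "k mod M = l mod M \<Longrightarrow> shift_set M k T = shift_set M l T"
  unfolding shift_set_def by (metis mod_add_right_eq)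

lemma shift_set_0:
  assumes "T \<subseteq> {..<M}"
  shows "shift_set M 0 T = T"
proof -
  have "shift_set M 0 T = (\<lambda>i. i) ` T"
    unfolding shift_set_def using assms by (intro image_cong) auto
  then show ?thesis by simp
qed

lemma shift_set_inverse:
  assumes "T \<subseteq> {..<M}"
  shows "shift_set M ((M - 1) * k) (shift_set M k T) = T"
proof (cases "M = 0")
  case True
  then show ?thesis using assms by (simp add: shift_set_def)
next
  case False
  then have "(M - 1) * k + k = M * k" by (cases M) auto
  then have "((M - 1) * k + k) mod M = 0 mod M" by simp
  then show ?thesis
    using shift_set_cong shift_set_0[OF assms] by (metis shift_set_shift_set)
qed

lemma card_shift_set:
  assumes "T \<subseteq> {..<M}"
  shows "card (shift_set M k T) = card T"
proof -
  have fin: "finite T" using assms finite_subset by blast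
  have "card T \<le> card (shift_set M k T)"
    using card_image_le[of "shift_set M k T" "\<lambda>i. (i + (M - 1) * k) mod M"]
      shift_set_inverse[OF assms, of k] fin by (simp add: shift_set_def)
  then show ?thesis using card_image_le[OF fin] unfolding shift_set_def by (rule le_antisym[rotated])
qed

text \<open>These sets consist of exponents: the units modulo a prime \<open>2 * m + 1\<close> form a cyclic group of order
  \<open>2 * m\<close> in which \<open>-1\<close> has exponent \<open>m\<close>, so sets that \<open>-1\<close> does not fix are those moved by the shift
  by \<open>m\<close>.\<close>
definition asym_sets :: "nat \<Rightarrow> nat \<Rightarrow> nat set set" where
  "asym_sets m r = {T. T \<subseteq> {..<2 * m} \<and> card T = r \<and> shift_set (2 * m) m T \<noteq> T}"

definition shift_rel :: "nat \<Rightarrow> nat set \<Rightarrow> nat \<Rightarrow> nat set rel" where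
  "shift_rel m K r = {(T, T'). T \<in> asym_sets m r \<and> T' \<in> asym_sets m r \<and>
     (\<exists>k\<in>K. T' = shift_set (2 * m) k T)}"

lemma shift_asym_sets:
  assumes "T \<in> asym_sets m r"
  shows "shift_set (2 * m) k T \<in> asym_sets m r"
proof -
  have T: "T \<subseteq> {..<2 * m}" "card T = r" "shift_set (2 * m) m T \<noteq> T"
    using assms by (auto simp: asym_sets_def)
  have "m > 0"
  proof (rule ccontr)
    assume "\<not> m > 0"
    then have "T = {}" using T by auto
    then show False using T(3) by (simp add: shift_set_def)
  qed
  then have sub: "shift_set (2 * m) l T \<subseteq> {..<2 * m}" for l by (auto simp: shift_set_def)
  have "shift_set (2 * m) m (shift_set (2 * m) k T) \<noteq> shift_set (2 * m) k T"
  proof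
    assume "shift_set (2 * m) m (shift_set (2 * m) k T) = shift_set (2 * m) k T"
    then have "shift_set (2 * m) k (shift_set (2 * m) m T) = shift_set (2 * m) k T"
      by (simp add: shift_set_shift_set add.commute)
    then show False using T shift_set_inverse[OF sub] shift_set_inverse[OF T(1)] by metis
  qed
  then show ?thesis using T sub card_shift_set[OF T(1)] by (simp add: asym_sets_def)
qed

lemma equiv_shift_rel:
  assumes K: "0 \<in> K" "\<And>k l. k \<in> K \<Longrightarrow> l \<in> K \<Longrightarrow> k + l \<in> K" "\<And>k c. k \<in> K \<Longrightarrow> c * k \<in> K"
  shows "equiv (asym_sets m r) (shift_rel m K r)"
proof (rule equivI)
  show "refl_on (asym_sets m r) (shift_rel m K r)"
  proof (rule refl_onI)
    fix T assume T: "T \<in> asym_sets m r"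
    then have "T = shift_set (2 * m) 0 T" by (simp add: asym_sets_def shift_set_0)
    then show "(T, T) \<in> shift_rel m K r" using T K(1) by (auto simp: shift_rel_def)
  qed
  show "sym (shift_rel m K r)"
  proof (rule symI)
    fix T T' assume T: "(T, T') \<in> shift_rel m K r"
    then obtain k where k: "k \<in> K" "T' = shift_set (2 * m) k T" by (auto simp: shift_rel_def)
    then have "T = shift_set (2 * m) ((2 * m - 1) * k) T'"
      using T shift_set_inverse[of T "2 * m" k] by (auto simp: shift_rel_def asym_sets_def)
    then show "(T', T) \<in> shift_rel m K r" using T K(3)[OF k(1)] by (auto simp: shift_rel_def)
  qed
  show "trans (shift_rel m K r)"
    using K(2) by (fastforce intro!: transI simp: shift_rel_def shift_set_shift_set)
qed (auto simp: shift_rel_def)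

lemma finite_asym_sets: "finite (asym_sets m r)"
  by (rule finite_subset[of _ "Pow {..<2 * m}"]) (auto simp: asym_sets_def)

text \<open>If a shift by an odd \<open>j\<close> fixes \<open>T\<close>, then so does the shift by \<open>m * j\<close>, which is congruent to \<open>m\<close>
  modulo \<open>2 * m\<close>.\<close>
lemma odd_shift_moves_asym_sets:
  assumes T: "T \<in> asym_sets m r" and "odd j"
  shows "shift_set (2 * m) j T \<noteq> T"
proof
  assume fix_j: "shift_set (2 * m) j T = T"
  have T': "T \<subseteq> {..<2 * m}" "shift_set (2 * m) m T \<noteq> T" using T by (auto simp: asym_sets_def)
  have "shift_set (2 * m) (c * j) T = T" for c
  proof (induction c)
    case (Suc c)
    then show ?case using fix_j shift_set_shift_set[of "2 * m" j "c * j" T] by simp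
  qed (simp add: shift_set_0 T')
  moreover have "(m * j) mod (2 * m) = m mod (2 * m)"
  proof -
    obtain i where "j = 2 * i + 1" using \<open>odd j\<close> by (rule oddE)
    then have "m * j = m + 2 * m * i" by (simp add: algebra_simps)
    then show ?thesis by simp
  qed
  ultimately show False using T'(2) shift_set_cong by metis
qed

text \<open>The source of the factor 2 in the identity: the stabiliser of an asymmetric set contains only even
  shifts, so its orbit under all shifts splits into two orbits under the even ones.\<close>
theorem card_even_shift_classes:
  "card (asym_sets m r // shift_rel m {k. even k} r) =
     2 * card (asym_sets m r // shift_rel m UNIV r)"
proof (rule card_quotient_index_two[where s = "shift_set (2 * m) 1"])
  let ?s = "shift_set (2 * m)"
  show "equiv (asym_sets m r) (shift_rel m {k. even k} r)" "equiv (asym_sets m r) (shift_rel m UNIV r)"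
    by (auto intro!: equiv_shift_rel)
  show "shift_rel m {k. even k} r \<subseteq> shift_rel m UNIV r" by (auto simp: shift_rel_def)
  fix T assume T: "T \<in> asym_sets m r"
  have "m > 0" using T by (cases m) (auto simp: asym_sets_def shift_set_def)
  have "?s 1 T \<noteq> ?s k T" if "even k" for k
  proof
    assume "?s 1 T = ?s k T"
    then have "?s ((2 * m - 1) * 1) (?s 1 T) = ?s ((2 * m - 1) * 1) (?s k T)" by simp
    then have "T = ?s (2 * m - 1 + k) T"
      using T shift_set_inverse[of T "2 * m" 1] by (simp add: asym_sets_def shift_set_shift_set)
    moreover have "odd (2 * m - 1 + k)" using that \<open>m > 0\<close> by simp
    ultimately show False using odd_shift_moves_asym_sets[OF T] by metis
  qed
  then show "(T, ?s 1 T) \<in> shift_rel m UNIV r \<and> (T, ?s 1 T) \<notin> shift_rel m {k. even k} r"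
    using T shift_asym_sets[OF T, of 1] by (auto simp: shift_rel_def)
next
  let ?s = "shift_set (2 * m)"
  fix T T' assume TT: "(T, T') \<in> shift_rel m UNIV r"
  then obtain k where T: "T \<in> asym_sets m r" "T' \<in> asym_sets m r" "T' = ?s k T"
    by (auto simp: shift_rel_def)
  show "(T, T') \<in> shift_rel m {k. even k} r \<or> (?s 1 T, T') \<in> shift_rel m {k. even k} r"
  proof (cases "even k")
    case True
    then show ?thesis using T by (auto simp: shift_rel_def)
  next
    case False
    then have "T' = ?s (k - 1) (?s 1 T)" using T by (simp add: shift_set_shift_set)
    moreover have "even (k - 1)" using False by simp
    ultimately have "(?s 1 T, T') \<in> shift_rel m {k. even k} r"
      using T(2) shift_asym_sets[OF T(1), of 1] unfolding shift_rel_def by blast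
    then show ?thesis ..
  qed
qed (rule finite_asym_sets)

section \<open>Connection sets up to multiplication by units\<close>

text \<open>The factor \<open>n - 1\<close> represents \<open>-1\<close>, so the last condition says that the Cayley digraph is not
  symmetric. The parameter \<open>Y\<close> serves to leave out the residue \<open>q\<close> modulo \<open>2 * q\<close>.\<close>
definition conn_sets :: "nat \<Rightarrow> nat set \<Rightarrow> nat \<Rightarrow> nat set set" where
  "conn_sets n Y r = {S. S \<subseteq> Y \<and> card S = r \<and> mult_set n (n - 1) S \<noteq> S}"

definition mult_rel :: "nat \<Rightarrow> nat set set \<Rightarrow> nat set rel" where
  "mult_rel n \<S> = {(S, S'). S \<in> \<S> \<and> S' \<in> \<S> \<and> (\<exists>u. coprime u n \<and> S' = mult_set n u S)}"

text \<open>If \<open>\<theta>\<close> labels \<open>Y\<close> by exponents so that multiplication by units becomes shifting by elements of \<open>K\<close>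
  and negation the shift by \<open>m\<close>, then the two kinds of classes correspond.\<close>
lemma card_mult_classes_eq_shift_classes:
  assumes bij: "bij_betw \<theta> {..<2 * m} Y"
    and neg: "\<And>i. i < 2 * m \<Longrightarrow> (n - 1) * \<theta> i mod n = \<theta> ((i + m) mod (2 * m))"
    and unit: "\<And>u. coprime u n \<Longrightarrow>
      \<exists>k\<in>K. \<forall>i<2 * m. u * \<theta> i mod n = \<theta> ((i + k) mod (2 * m))"
    and shift: "\<And>k. k \<in> K \<Longrightarrow>
      \<exists>u. coprime u n \<and> (\<forall>i<2 * m. u * \<theta> i mod n = \<theta> ((i + k) mod (2 * m)))"
  shows "card (conn_sets n Y r // mult_rel n (conn_sets n Y r)) =
    card (asym_sets m r // shift_rel m K r)"
proof (rule card_quotient_bij[where F = "image \<theta>", symmetric])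
  have inj: "inj_on \<theta> {..<2 * m}" and Y: "Y = \<theta> ` {..<2 * m}"
    using bij by (auto simp: bij_betw_def)
  have image_mult: "mult_set n u (\<theta> ` T) = \<theta> ` shift_set (2 * m) k T"
    if "T \<subseteq> {..<2 * m}" "\<forall>i<2 * m. u * \<theta> i mod n = \<theta> ((i + k) mod (2 * m))" for u k T
    unfolding mult_set_def shift_set_def image_image using that by (intro image_cong) auto
  have shift_sub: "shift_set (2 * m) k T \<subseteq> {..<2 * m}" if "T \<subseteq> {..<2 * m}" for k T
    using that by (cases "m = 0") (auto simp: shift_set_def)
  have image_eq: "\<theta> ` T = \<theta> ` T' \<longleftrightarrow> T = T'" if "T \<subseteq> {..<2 * m}" "T' \<subseteq> {..<2 * m}" for T T'
    using inj_on_image_eq_iff[OF inj that] .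
  have mem: "\<theta> ` T \<in> conn_sets n Y r \<longleftrightarrow> T \<in> asym_sets m r" if "T \<subseteq> {..<2 * m}" for T
    using that image_mult[OF that, of "n - 1" m] neg image_eq[OF shift_sub[OF that] that]
    by (auto simp: conn_sets_def asym_sets_def Y card_image inj_on_subset[OF inj])
  show "bij_betw (image \<theta>) (asym_sets m r) (conn_sets n Y r)"
    unfolding bij_betw_def
  proof
    show "inj_on (image \<theta>) (asym_sets m r)"
      using image_eq by (auto simp: inj_on_def asym_sets_def)
    show "image \<theta> ` asym_sets m r = conn_sets n Y r"
    proof
      show "image \<theta> ` asym_sets m r \<subseteq> conn_sets n Y r"
        using mem by (auto simp: asym_sets_def)
      show "conn_sets n Y r \<subseteq> image \<theta> ` asym_sets m r"
      proof
        fix S assume S: "S \<in> conn_sets n Y r"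
        then obtain T where "T \<subseteq> {..<2 * m}" "S = \<theta> ` T"
          unfolding conn_sets_def Y by (auto simp: subset_image_iff)
        then show "S \<in> image \<theta> ` asym_sets m r" using S mem by auto
      qed
    qed
  qed
  show "shift_rel m K r \<subseteq> asym_sets m r \<times> asym_sets m r" by (auto simp: shift_rel_def)
  show "mult_rel n (conn_sets n Y r) \<subseteq> conn_sets n Y r \<times> conn_sets n Y r"
    by (auto simp: mult_rel_def)
  fix T T' assume T: "T \<in> asym_sets m r" "T' \<in> asym_sets m r"
  then have sub: "T \<subseteq> {..<2 * m}" "T' \<subseteq> {..<2 * m}" by (auto simp: asym_sets_def)
  have "(\<exists>u. coprime u n \<and> \<theta> ` T' = mult_set n u (\<theta> ` T)) \<longleftrightarrow>
      (\<exists>k\<in>K. T' = shift_set (2 * m) k T)"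
    using unit shift image_mult[OF sub(1)] image_eq[OF sub(2) shift_sub[OF sub(1)]] by metis
  then show "(\<theta> ` T, \<theta> ` T') \<in> mult_rel n (conn_sets n Y r) \<longleftrightarrow> (T, T') \<in> shift_rel m K r"
    using T mem sub by (simp add: mult_rel_def shift_rel_def)
qed

text \<open>If \<open>j\<close> is the exponent of \<open>-1\<close>, then \<open>2 * j\<close> is a multiple of the order \<open>totient n\<close> strictly
  between \<open>0\<close> and \<open>2 * totient n\<close>.\<close>
lemma primroot_neg_one:
  assumes "residue_primroot n g" "n > 2"
  shows "even (totient n)" "g ^ (totient n div 2) mod n = n - 1"
proof -
  have "n - 1 \<in> totatives n" using assms minus_one_in_totatives[of n] by simp
  then obtain j where j: "j < totient n" "n - 1 = g ^ j mod n"
    using residue_primroot_is_generator[OF _ assms(1)] assms(2) by (auto simp: bij_betw_def)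
  have "int ((n - 1) * (n - 1)) mod int n = 1"
  proof -
    have "int (n - 1) = int n - 1" using assms(2) by simp
    then have "int ((n - 1) * (n - 1)) = (int n - 1) * (int n - 1)" by (simp only: of_nat_mult)
    also have "\<dots> = 1 + int n * (int n - 2)" by (simp add: algebra_simps)
    finally have "int ((n - 1) * (n - 1)) = 1 + int n * (int n - 2)" .
    then show ?thesis using assms(2) by simp
  qed
  then have "(n - 1) * (n - 1) mod n = 1" by (metis of_nat_eq_1_iff zmod_int)
  moreover have "g ^ (2 * j) mod n = (n - 1) * (n - 1) mod n"
    unfolding mult_2 power_add by (simp only: j(2) mod_mult_eq)
  ultimately have "[g ^ (2 * j) = 1] (mod n)" using assms(2) by (simp add: cong_def)
  then have "totient n dvd 2 * j"
    using assms(1) by (metis ord_divides residue_primroot_def)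
  then obtain c where c: "2 * j = totient n * c" ..
  have "j \<noteq> 0" using j assms(2) by (cases j) auto
  then have "c \<noteq> 0" using c by (intro notI) simp
  moreover have "totient n * c < totient n * 2" using c j(1) by linarith
  ultimately have "c = 1" by auto
  then have "totient n = 2 * j" using c by simp
  then show "even (totient n)" "g ^ (totient n div 2) mod n = n - 1"
    using j(2) by simp_all
qed

lemma primroot_power_mod_totient:
  assumes "residue_primroot n g"
  shows "g ^ (i mod totient n) mod n = g ^ i mod n"
proof -
  have "[g ^ (totient n) = 1] (mod n)"
    using assms by (metis ord_divides dvd_refl residue_primroot_def)
  then have "[(g ^ totient n) ^ (i div totient n) = 1 ^ (i div totient n)] (mod n)"
    by (rule cong_pow)
  then have "[g ^ (i mod totient n) * g ^ (totient n * (i div totient n)) = g ^ (i mod totient n) * 1] (mod n)"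
    by (intro cong_mult cong_refl) (simp add: power_mult)
  then show ?thesis by (simp add: cong_def flip: power_add)
qed

lemma primroot_power_surj:
  assumes "residue_primroot n g" "n > 1" "coprime u n"
  obtains k where "g ^ k mod n = u mod n"
proof -
  have "u mod n \<in> totatives n"
    using assms by (auto simp: in_totatives_iff intro!: Nat.gr0I) 
  then show thesis
    using residue_primroot_is_generator[OF assms(2,1)] that by (force simp: bij_betw_def)
qed

lemma card_mult_classes_prime:
  assumes p: "prime p" "p = 2 * m + 1"
  shows "card (conn_sets p {1..<p} r // mult_rel p (conn_sets p {1..<p} r)) =
    card (asym_sets m r // shift_rel m UNIV r)"
proof -
  have p1: "p > 1" using p prime_gt_1_nat by blast
  then have "p > 2" using p(2) by (cases "p = 2") auto
  have odd: "odd p" using p by simp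
  obtain g where g: "residue_primroot p g"
    using residue_primroot_odd_prime_power_exists[OF p(1) odd] by (metis power_one_right zero_less_one)
  have tot: "totient p = 2 * m" using p by (simp add: totient_prime)
  have "{0<..<p} = {1..<p}" by auto
  then have "totatives p = {1..<p}" using totatives_prime[OF p(1)] by (simp only:)
  then have bij: "bij_betw (\<lambda>i. g ^ i mod p) {..<2 * m} {1..<p}"
    using residue_primroot_is_generator[OF p1 g] tot by simp
  have step: "u * (g ^ i mod p) mod p = g ^ ((i + k) mod (2 * m)) mod p"
    if "g ^ k mod p = u mod p" for u k i
  proof -
    have "g ^ ((i + k) mod (2 * m)) mod p = g ^ (i + k) mod p"
      using primroot_power_mod_totient[OF g] tot by simp
    also have "\<dots> = (g ^ i mod p) * (u mod p) mod p"
      by (simp only: power_add mod_mult_eq flip: that)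
    also have "\<dots> = u * (g ^ i mod p) mod p" by (metis mod_mult_right_eq mult.commute)
    finally show ?thesis by (rule sym)
  qed
  show ?thesis
  proof (rule card_mult_classes_eq_shift_classes[OF bij])
    show "(p - 1) * (g ^ i mod p) mod p = g ^ ((i + m) mod (2 * m)) mod p" for i
      using primroot_neg_one[OF g \<open>p > 2\<close>] tot p1 by (intro step) simp
    show "\<exists>k\<in>UNIV. \<forall>i<2 * m. u * (g ^ i mod p) mod p = g ^ ((i + k) mod (2 * m)) mod p"
      if "coprime u p" for u
      using primroot_power_surj[OF g p1 that] step by (metis UNIV_I)
    show "\<exists>u. coprime u p \<and> (\<forall>i<2 * m. u * (g ^ i mod p) mod p = g ^ ((i + k) mod (2 * m)) mod p)" for k
    proof (intro exI conjI allI impI)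
      show "coprime (g ^ k) p"
        using g by (simp add: residue_primroot_def coprime_commute)
    qed (rule step, simp)
  qed
qed

text \<open>The residues modulo \<open>2 * q\<close> other than \<open>0\<close> and \<open>q\<close> form two regular orbits of the unit group, the
  units and their doubles. Labelling the powers \<open>g ^ k\<close> of a primitive root by \<open>2 * k\<close> and their doubles
  by \<open>2 * k + 1\<close> identifies them with the exponents modulo \<open>2 * m\<close> on which multiplication by \<open>g\<close> is the
  shift by 2. Compared with the prime modulus \<open>2 * m + 1\<close>, only the even shifts remain.\<close>
lemma card_mult_classes_double_prime:
  assumes q: "prime q" "odd q" and n: "n = 2 * q" and m: "m = q - 1"
  shows "card (conn_sets n ({1..<n} - {q}) r // mult_rel n (conn_sets n ({1..<n} - {q}) r)) =
    card (asym_sets m r // shift_rel m {k. even k} r)"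
proof -
  have q2: "q > 2" using q prime_ge_2_nat[OF q(1)] by (cases "q = 2") auto
  then have n2: "n > 2" "n > 1" by (auto simp: n)
  have "n \<in> cyclic_moduli"
  proof -
    have "n = 2 * q ^ 1 \<and> prime q \<and> odd q \<and> (1::nat) > 0" using q n by simp
    then show ?thesis unfolding cyclic_moduli_def by blast
  qed
  then obtain g where g: "residue_primroot n g" using residue_primroot_iff_in_cyclic_moduli by blast
  have tot: "totient n = m" using q by (simp add: n m totient_double totient_prime)
  define \<theta> where "\<theta> i = (if even i then 1 else 2) * g ^ (i div 2) mod n" for i
  have step: "u * \<theta> i mod n = \<theta> ((i + 2 * k) mod (2 * m))" if k: "g ^ k mod n = u mod n" for u k i
  proof -
    define j where "j = (i + 2 * k) mod (2 * m)"
    define c where "c = (if even i then 1 else 2 :: nat)"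
    have "even j = even i" unfolding j_def by (simp add: dvd_mod_iff)
    moreover have "j div 2 = (i div 2 + k) mod m"
      unfolding j_def by (simp add: mod_mult2_eq add.commute)
    ultimately have "\<theta> j = c * g ^ ((i div 2 + k) mod m) mod n"
      by (simp only: \<theta>_def c_def)
    also have "\<dots> = c * (g ^ (i div 2 + k) mod n) mod n"
      using primroot_power_mod_totient[OF g, of "i div 2 + k"] tot by (metis mod_mult_right_eq)
    also have "\<dots> = c * g ^ (i div 2) * (g ^ k mod n) mod n"
      by (metis mod_mult_right_eq power_add mult.assoc)
    also have "\<dots> = c * g ^ (i div 2) * u mod n" by (simp only: k mod_mult_right_eq)
    also have "\<dots> = u * (c * g ^ (i div 2) mod n) mod n"
      by (simp only: mod_mult_right_eq mult.commute)
    also have "c * g ^ (i div 2) mod n = \<theta> i" by (simp only: \<theta>_def c_def)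
    finally show ?thesis unfolding j_def by (rule sym)
  qed
  have bij: "bij_betw \<theta> {..<2 * m} ({1..<n} - {q})"
  proof -
    have sur: "{1..<n} - {q} \<subseteq> \<theta> ` {..<2 * m}"
    proof
      fix y assume y: "y \<in> {1..<n} - {q}"
      define c where "c = (if even y then 2 else 1 :: nat)"
      have "\<exists>u. coprime u n \<and> y = c * u mod n"
      proof (cases "even y")
        case True
        then obtain a where a: "y = 2 * a" ..
        have "\<not> q dvd a" using y a n by (auto dest: dvd_imp_le)
        then have "coprime a q" using q(1) prime_imp_coprime coprime_commute by blast
        then obtain u where u: "coprime u n" "[u = a] (mod q)"
          using odd_representative[OF q(2)] unfolding n by blast
        have "2 * u mod n = y"
          using cong_double[OF u(2)] y a by (simp add: cong_def n)
        then show ?thesis using u True by (auto simp: c_def)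
      next
        case False
        have "\<not> q dvd y"
        proof
          assume "q dvd y"
          then obtain b where b: "y = q * b" ..
          then have "b < 2" using y n by auto
          then have "b = 0 \<or> b = 1" by auto
          then show False using b y by auto
        qed
        then have "coprime y q" using q(1) prime_imp_coprime coprime_commute by blast
        then show ?thesis using False y by (intro exI[of _ y]) (simp add: n c_def coprime_double_iff)
      qed
      then obtain u where u: "coprime u n" "y = c * u mod n" by blast
      obtain k where k: "g ^ k mod n = u mod n" using primroot_power_surj[OF g n2(2) u(1)] .
      define i where "i = 2 * (k mod m) + (if even y then 1 else 0)"
      have "i div 2 = k mod m" "even i \<longleftrightarrow> odd y" by (auto simp: i_def)
      then have "\<theta> i = c * g ^ (k mod m) mod n" by (simp add: \<theta>_def c_def)
      also have "\<dots> = y"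
        using primroot_power_mod_totient[OF g, of k] k u tot by (metis mod_mult_right_eq)
      finally have "\<theta> i = y" .
      moreover have "i < 2 * m"
      proof -
        have "k mod m < m" using q2 m by simp
        then show ?thesis by (auto simp: i_def)
      qed
      ultimately show "y \<in> \<theta> ` {..<2 * m}" by blast
    qed
    have cardY: "card ({1..<n} - {q}) = 2 * m" using q2 by (simp add: n m)
    have "\<theta> ` {..<2 * m} = {1..<n} - {q}"
      using card_seteq[OF _ sur] card_image_le[of "{..<2 * m}" \<theta>] cardY by simp
    then show ?thesis
      using cardY by (simp add: bij_betw_def eq_card_imp_inj_on)
  qed
  show ?thesis
  proof (rule card_mult_classes_eq_shift_classes[OF bij])
    show "(n - 1) * \<theta> i mod n = \<theta> ((i + m) mod (2 * m))" for i
    proof -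
      have "even m" using primroot_neg_one(1)[OF g n2(1)] tot by simp
      moreover have "g ^ (m div 2) mod n = (n - 1) mod n"
        using primroot_neg_one(2)[OF g n2(1)] tot n2 by simp
      ultimately show ?thesis using step[of "m div 2" "n - 1" i] by simp
    qed
    show "\<exists>k\<in>{k. even k}. \<forall>i<2 * m. u * \<theta> i mod n = \<theta> ((i + k) mod (2 * m))"
      if "coprime u n" for u
    proof -
      from primroot_power_surj[OF g n2(2) that]
      obtain k where k: "g ^ k mod n = u mod n" .
      show ?thesis by (rule bexI[of _ "2 * k"]) (use step[OF k] in auto)
    qed
    show "\<exists>u. coprime u n \<and> (\<forall>i<2 * m. u * \<theta> i mod n = \<theta> ((i + k) mod (2 * m)))"
      if "k \<in> {k. even k}" for k
    proof -
      from that obtain j where j: "k = 2 * j" by auto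
      have "coprime (g ^ j) n"
        using g by (simp add: residue_primroot_def coprime_commute)
      then show ?thesis using step[of j "g ^ j"] unfolding j by blast
    qed
  qed
qed

lemma finite_conn_sets: "finite Y \<Longrightarrow> finite (conn_sets n Y r)"
  by (rule finite_subset[of _ "Pow Y"]) (auto simp: conn_sets_def)

lemma insert_half_mult_set:
  assumes "coprime u (2 * q)" "q > 0"
  shows "mult_set (2 * q) u (insert q S) = insert q (mult_set (2 * q) u S)"
proof -
  have "odd u" using assms(1) by simp
  then obtain c where "u = 2 * c + 1" by (rule oddE)
  then have "u * q = q + 2 * q * c" by (simp add: algebra_simps)
  then have "u * q mod (2 * q) = q" using assms(2) by (simp only: mod_mult_self2) simp
  then show ?thesis by (simp only: mult_set_def image_insert)
qed

lemma half_in_mult_set_iff: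
  assumes "coprime u (2 * q)" "q > 0" "S \<subseteq> {..<2 * q}"
  shows "q \<in> mult_set (2 * q) u S \<longleftrightarrow> q \<in> S"
proof -
  have "u * q mod (2 * q) = q" 
    using insert_half_mult_set[OF assms(1,2), of "{}"] by (simp add: mult_set_def)
  then show ?thesis using mult_mod_in_mult_set[OF assms(1,3), of q] assms(2) by simp
qed

lemma card_mult_classes_with_half:
  assumes "q > 1" "Y = {1..<2 * q} - {q}" "A = {S \<in> conn_sets (2 * q) {1..<2 * q} (Suc r). q \<in> S}"
  shows "card (A // mult_rel (2 * q) A) =
    card (conn_sets (2 * q) Y r // mult_rel (2 * q) (conn_sets (2 * q) Y r))"
proof (rule card_quotient_bij[where F = "insert q", symmetric])
  let ?n = "2 * q"
  have q0: "q > 0" using assms(1) by simp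
  have neg: "coprime (?n - 1) ?n" using assms(1) coprime_diff_one_left_nat[of ?n] by simp
  have half: "q \<notin> mult_set ?n u S" if "S \<subseteq> Y" "coprime u ?n" for u S
  proof -
    have "S \<subseteq> {..<?n}" "q \<notin> S" using that(1) assms(2) by auto
    then show ?thesis using half_in_mult_set_iff[OF that(2) q0] by blast
  qed
  have ins: "insert q S' = mult_set ?n u (insert q S) \<longleftrightarrow> S' = mult_set ?n u S"
    if "S \<subseteq> Y" "S' \<subseteq> Y" "coprime u ?n" for u S S'
  proof -
    have "q \<notin> S'" using that(2) assms(2) by auto
    then show ?thesis using insert_half_mult_set[OF that(3) q0, of S] half[OF that(1,3)]
      by (metis insert_ident)
  qed
  have mem: "insert q S \<in> A \<longleftrightarrow> S \<in> conn_sets ?n Y r" if "S \<subseteq> Y" for S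
  proof -
    have "finite S" "q \<notin> S" using that assms(2) by (auto intro: finite_subset)
    moreover have "insert q S \<subseteq> {1..<?n}" using that assms by auto
    ultimately show ?thesis
      using that ins[OF that that neg] unfolding assms(3) conn_sets_def by auto
  qed
  show "bij_betw (insert q) (conn_sets ?n Y r) A"
    unfolding bij_betw_def
  proof
    show "inj_on (insert q) (conn_sets ?n Y r)"
    proof (rule inj_onI)
      fix S S' assume "S \<in> conn_sets ?n Y r" "S' \<in> conn_sets ?n Y r" "insert q S = insert q S'"
      moreover have "q \<notin> S" "q \<notin> S'" using calculation assms(2) by (auto simp: conn_sets_def)
      ultimately show "S = S'" by (simp add: insert_ident)
    qed
    show "insert q ` conn_sets ?n Y r = A"
    proof
      show "insert q ` conn_sets ?n Y r \<subseteq> A" using mem by (auto simp: conn_sets_def)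
      show "A \<subseteq> insert q ` conn_sets ?n Y r"
      proof
        fix S assume S: "S \<in> A"
        then have "S = insert q (S - {q})" "S - {q} \<subseteq> Y"
          using assms(2,3) by (auto simp: conn_sets_def)
        then show "S \<in> insert q ` conn_sets ?n Y r" using S mem by (metis image_eqI)
      qed
    qed
  qed
  show "mult_rel ?n (conn_sets ?n Y r) \<subseteq> conn_sets ?n Y r \<times> conn_sets ?n Y r"
    "mult_rel ?n A \<subseteq> A \<times> A" by (auto simp: mult_rel_def)
  fix S S' assume S: "S \<in> conn_sets ?n Y r" "S' \<in> conn_sets ?n Y r"
  then have "S \<subseteq> Y" "S' \<subseteq> Y" by (auto simp: conn_sets_def)
  then show "(insert q S, insert q S') \<in> mult_rel ?n A \<longleftrightarrow> (S, S') \<in> mult_rel ?n (conn_sets ?n Y r)"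
    using S mem ins unfolding mult_rel_def by blast
qed

text \<open>Every unit modulo \<open>2 * q\<close> is odd and so fixes the residue \<open>q\<close>; whether \<open>q\<close> belongs to \<open>S\<close> is
  therefore invariant and independent of the rest. In the final identity this yields the factor \<open>1 + z\<close>.\<close>
lemma card_mult_classes_split:
  assumes "q > 1" "n = 2 * q" "Y = {1..<n} - {q}"
  shows "card (conn_sets n {1..<n} r // mult_rel n (conn_sets n {1..<n} r)) =
    card (conn_sets n Y r // mult_rel n (conn_sets n Y r)) +
    (case r of 0 \<Rightarrow> 0 | Suc r' \<Rightarrow> card (conn_sets n Y r' // mult_rel n (conn_sets n Y r')))"
proof -
  let ?A = "conn_sets n {1..<n} r"
  let ?R = "mult_rel n ?A"
  have "refl_on ?A ?R"
  proof (rule refl_onI)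
    fix S assume S: "S \<in> ?A"
    then have "S \<subseteq> {..<n}" by (auto simp: conn_sets_def)
    then have "S = mult_set n 1 S" by (simp only: mult_set_1)
    then show "(S, S) \<in> ?R" using S coprime_1_left unfolding mult_rel_def by blast
  qed
  moreover have "q \<in> S \<longleftrightarrow> q \<in> S'" if "(S, S') \<in> ?R" for S S'
  proof -
    from that obtain u where u: "coprime u n" "S' = mult_set n u S" and "S \<in> ?A"
      by (auto simp: mult_rel_def)
    then have "S \<subseteq> {..<n}" by (auto simp: conn_sets_def)
    then show ?thesis using half_in_mult_set_iff[of u q S] u assms by simp
  qed
  moreover have "?R \<subseteq> ?A \<times> ?A" by (auto simp: mult_rel_def)
  moreover have "?R \<inter> {S \<in> ?A. P S} \<times> {S \<in> ?A. P S} = mult_rel n {S \<in> ?A. P S}" for P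
    by (auto simp: mult_rel_def)
  ultimately have "card (?A // ?R) =
      card ({S \<in> ?A. q \<in> S} // mult_rel n {S \<in> ?A. q \<in> S}) +
      card ({S \<in> ?A. q \<notin> S} // mult_rel n {S \<in> ?A. q \<notin> S})"
    using card_quotient_split[OF finite_conn_sets[of "{1..<n}" n r], of ?R "\<lambda>S. q \<in> S"] by simp
  moreover have "{S \<in> ?A. q \<notin> S} = conn_sets n Y r"
    using assms by (auto simp: conn_sets_def)
  moreover have "card ({S \<in> ?A. q \<in> S} // mult_rel n {S \<in> ?A. q \<in> S}) =
      (case r of 0 \<Rightarrow> 0 | Suc r' \<Rightarrow> card (conn_sets n Y r' // mult_rel n (conn_sets n Y r')))"
  proof (cases r)
    case 0
    then have empty: "{S \<in> ?A. q \<in> S} = {}" by (auto simp: conn_sets_def finite_subset)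
    show ?thesis unfolding empty using 0 by simp
  next
    case (Suc r')
    then show ?thesis
      using card_mult_classes_with_half[OF assms(1), of Y _ r'] assms(2,3) by simp
  qed
  ultimately show ?thesis by simp
qed

section \<open>Circulants as Cayley digraphs\<close>

definition cay :: "nat \<Rightarrow> nat set \<Rightarrow> nat pair_pre_digraph" where
  "cay n S = \<lparr>pverts = {0..<n}, parcs = {(x, y). x < n \<and> y < n \<and> offset n x y \<in> S}\<rparr>"

lemma parcs_cay: "(x, y) \<in> parcs (cay n S) \<longleftrightarrow> x < n \<and> y < n \<and> offset n x y \<in> S"
  by (simp add: cay_def)

lemma pverts_cay: "pverts (cay n S) = {0..<n}"
  by (simp add: cay_def)

lemma pair_digraph_cay:
  assumes "S \<subseteq> {1..<n}"
  shows "pair_digraph (cay n S)"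
proof
  fix e assume e: "e \<in> parcs (cay n S)"
  obtain x y where xy: "e = (x, y)" by (cases e)
  show "fst e \<in> pverts (cay n S)" "snd e \<in> pverts (cay n S)"
    using e by (auto simp: xy parcs_cay pverts_cay)
  have "offset n x y \<noteq> 0" using e assms by (auto simp: xy parcs_cay)
  then show "fst e \<noteq> snd e"
    using e offset_eq_0_iff[of x n y] by (auto simp: xy parcs_cay)
next
  show "finite (pverts (cay n S))" by (simp add: pverts_cay)
  show "finite (parcs (cay n S))"
    by (rule finite_subset[of _ "{0..<n} \<times> {0..<n}"]) (auto simp: cay_def)
qed

lemma circulant_cay:
  assumes "n > 0" "S \<subseteq> {1..<n}"
  shows "circulant n (cay n S)"
proof -
  let ?r = "\<lambda>v. (v + 1) mod n"
  have "map_prod ?r ?r ` parcs (cay n S) = parcs (cay n S)"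
  proof
    show "map_prod ?r ?r ` parcs (cay n S) \<subseteq> parcs (cay n S)"
      using offset_add[OF assms(1), of _ 1] assms(1) by (auto simp: parcs_cay)
    show "parcs (cay n S) \<subseteq> map_prod ?r ?r ` parcs (cay n S)"
    proof (rule subrelI)
      fix x y assume xy: "(x, y) \<in> parcs (cay n S)"
      have unshift: "?r ((z + (n - 1)) mod n) = z" if "z < n" for z
      proof -
        have "?r ((z + (n - 1)) mod n) = (z + (n - 1) + 1) mod n" by (rule mod_add_left_eq)
        also have "z + (n - 1) + 1 = z + n" using assms(1) by simp
        finally show ?thesis using that by simp
      qed
      have "((x + (n - 1)) mod n, (y + (n - 1)) mod n) \<in> parcs (cay n S)"
        using xy assms(1) unfolding parcs_cay offset_add[OF assms(1)] by simp
      moreover have "map_prod ?r ?r ((x + (n - 1)) mod n, (y + (n - 1)) mod n) = (x, y)"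
        using xy unshift by (simp add: parcs_cay)
      ultimately show "(x, y) \<in> map_prod ?r ?r ` parcs (cay n S)" by (metis image_eqI)
    qed
  qed
  then show ?thesis
    using pair_digraph_cay[OF assms(2)] by (simp add: circulant_def pverts_cay)
qed

lemma circulant_imp_cay:
  assumes "n > 0" "circulant n G"
  obtains S where "S \<subseteq> {1..<n}" "G = cay n S"
proof -
  interpret pair_digraph G using assms(2) by (simp add: circulant_def)
  have V: "pverts G = {0..<n}" using assms(2) by (simp add: circulant_def)
  have less: "x < n" "y < n" if "(x, y) \<in> parcs G" for x y
    using in_arcsD1[OF that] in_arcsD2[OF that] by (auto simp: V)
  have shift: "((x + k) mod n, (y + k) mod n) \<in> parcs G" if "(x, y) \<in> parcs G" for x y k
  proof (induction k)
    case 0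
    show ?case using that less[OF that] by simp
  next
    case (Suc k)
    let ?r = "\<lambda>v. (v + 1) mod n"
    have "map_prod ?r ?r ((x + k) mod n, (y + k) mod n) \<in> map_prod ?r ?r ` parcs G"
      using Suc by (rule imageI)
    also have "\<dots> = parcs G" using assms(2) by (simp add: circulant_def)
    finally show ?case by (simp add: mod_simps)
  qed
  define S where "S = {s. (0, s) \<in> parcs G}"
  have "S \<subseteq> {1..<n}"
  proof
    fix s assume "s \<in> S"
    then have s: "(0, s) \<in> parcs G" by (simp add: S_def)
    then have "s \<noteq> 0" using pair_no_loops[OF s] by auto
    then show "s \<in> {1..<n}" using less[OF s] by auto
  qed
  moreover have "(x, y) \<in> parcs G \<longleftrightarrow> (x, y) \<in> parcs (cay n S)" for x y
  proof
    assume xy: "(x, y) \<in> parcs G"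
    let ?k = "n - x"
    have x: "(x + ?k) mod n = 0" using less[OF xy] by simp
    have "(0, (y + ?k) mod n) \<in> parcs G" using shift[OF xy, of ?k] x by simp
    moreover have "(y + ?k) mod n = offset n x y"
      using offset_add[OF assms(1), of x ?k y] assms(1) x by (simp add: offset_zero_left)
    ultimately show "(x, y) \<in> parcs (cay n S)"
      using less[OF xy] by (simp add: parcs_cay S_def)
  next
    assume "(x, y) \<in> parcs (cay n S)"
    then have xy: "x < n" "y < n" "(0, offset n x y) \<in> parcs G" by (auto simp: parcs_cay S_def)
    then have "((0 + x) mod n, (offset n x y + x) mod n) \<in> parcs G" by (intro shift)
    then show "(x, y) \<in> parcs G"
      using xy plus_offset[OF xy(2), of x] by (simp add: add.commute)
  qed
  then have "parcs G = parcs (cay n S)" by auto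
  then have "G = cay n S" using V by (simp add: cay_def)
  ultimately show thesis by (rule that)
qed

lemma cay_inj:
  assumes "S \<subseteq> {1..<n}" "S' \<subseteq> {1..<n}" "cay n S = cay n S'"
  shows "S = S'"
proof -
  have "s \<in> S \<longleftrightarrow> s \<in> S'" if "s < n" for s
  proof -
    have "(0, s) \<in> parcs (cay n S) \<longleftrightarrow> (0, s) \<in> parcs (cay n S')" using assms(3) by simp
    then show ?thesis using that by (simp add: parcs_cay offset_zero_left)
  qed
  then show ?thesis using assms by (meson atLeastLessThan_iff subsetD subsetI subset_antisym)
qed

lemma out_degree_cay:
  assumes "S \<subseteq> {1..<n}" "v < n"
  shows "out_degree (with_proj (cay n S)) v = card S"
proof -
  have "bij_betw (\<lambda>s. (v, (v + s) mod n)) S (out_arcs (with_proj (cay n S)) v)"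
  proof (rule bij_betwI[where g = "\<lambda>(x, y). offset n x y"])
    show "(\<lambda>s. (v, (v + s) mod n)) \<in> S \<rightarrow> out_arcs (with_proj (cay n S)) v"
      using assms by (auto simp: out_arcs_def parcs_cay offset_plus subset_iff)
    show "(\<lambda>(x, y). offset n x y) \<in> out_arcs (with_proj (cay n S)) v \<rightarrow> S"
      by (auto simp: out_arcs_def parcs_cay)
    show "(case (v, (v + s) mod n) of (x, y) \<Rightarrow> offset n x y) = s" if "s \<in> S" for s
      using that assms(1) by (auto simp: offset_plus subset_iff)
    show "(v, (v + (case e of (x, y) \<Rightarrow> offset n x y)) mod n) = e"
      if "e \<in> out_arcs (with_proj (cay n S)) v" for e
      using that by (cases e) (auto simp: out_arcs_def parcs_cay plus_offset)
  qed
  then show ?thesis by (simp add: out_degree_def bij_betw_same_card)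
qed

lemma offset_swap:
  assumes "n > 0"
  shows "offset n y x = (n - 1) * offset n x y mod n"
proof -
  have n: "int (n - 1) = int n - 1" using assms by simp
  have "int ((n - 1) * offset n x y mod n) = ((int n - 1) * (int y - int x)) mod int n"
    using assms by (simp only: zmod_int of_nat_mult int_offset n mod_mult_right_eq)
  also have "(int n - 1) * (int y - int x) = (int x - int y) + int n * (int y - int x)"
    by (simp add: algebra_simps)
  finally have "int ((n - 1) * offset n x y mod n) = int (offset n y x)"
    using assms by (simp add: int_offset)
  then show ?thesis by simp
qed

lemma in_degree_cay:
  assumes "S \<subseteq> {1..<n}" "v < n"
  shows "in_degree (with_proj (cay n S)) v = card S"
proof -
  have n: "n > 0" using assms(2) by simp
  have unshift: "((v + (n - s)) mod n + s) mod n = v" if "s < n" for s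
  proof -
    have "((v + (n - s)) mod n + s) mod n = (v + (n - s) + s) mod n" by (rule mod_add_left_eq)
    also have "v + (n - s) + s = v + n" using that by simp
    finally show ?thesis using assms(2) by simp
  qed
  have off: "offset n ((v + (n - s)) mod n) v = s" if "s < n" for s
    using offset_plus[OF that, of "(v + (n - s)) mod n"] unshift[OF that] by simp
  have "bij_betw (\<lambda>s. ((v + (n - s)) mod n, v)) S (in_arcs (with_proj (cay n S)) v)"
  proof (rule bij_betwI[where g = "\<lambda>(x, y). offset n x y"])
    show "(\<lambda>s. ((v + (n - s)) mod n, v)) \<in> S \<rightarrow> in_arcs (with_proj (cay n S)) v"
      using assms off n by (auto simp: in_arcs_def parcs_cay subset_iff)
    show "(\<lambda>(x, y). offset n x y) \<in> in_arcs (with_proj (cay n S)) v \<rightarrow> S"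
      by (auto simp: in_arcs_def parcs_cay)
    show "(case ((v + (n - s)) mod n, v) of (x, y) \<Rightarrow> offset n x y) = s" if "s \<in> S" for s
      using that assms(1) off by (auto simp: subset_iff)
    show "((v + (n - (case e of (x, y) \<Rightarrow> offset n x y))) mod n, v) = e"
      if "e \<in> in_arcs (with_proj (cay n S)) v" for e
    proof -
      obtain x where e: "e = (x, v)" "x < n"
        using \<open>e \<in> _\<close> by (cases e) (auto simp: in_arcs_def parcs_cay)
      have o: "offset n x v < n" using offset_less[OF n] .
      have "(v + (n - offset n x v)) mod n = ((x + offset n x v) mod n + (n - offset n x v)) mod n"
        using plus_offset[OF assms(2), of x] by simp
      also have "\<dots> = (x + offset n x v + (n - offset n x v)) mod n" by (rule mod_add_left_eq)
      also have "x + offset n x v + (n - offset n x v) = x + n" using o by simp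
      finally show ?thesis using e by simp
    qed
  qed
  then show ?thesis by (simp add: in_degree_def bij_betw_same_card)
qed

lemma regular_cay_iff:
  assumes "n > 0" "S \<subseteq> {1..<n}"
  shows "regular_of_valency (with_proj (cay n S)) r \<longleftrightarrow> card S = r"
  using assms out_degree_cay[OF assms(2)] in_degree_cay[OF assms(2)]
  by (auto simp: regular_of_valency_def pverts_cay)

lemma symmetric_cay_iff:
  assumes "n > 0" "S \<subseteq> {1..<n}"
  shows "symmetric (with_proj (cay n S)) \<longleftrightarrow> mult_set n (n - 1) S = S"
proof -
  have "arcs_ends (with_proj (cay n S)) = parcs (cay n S)"
    by (auto simp: arcs_ends_def arc_to_ends_def)
  then have sym: "symmetric (with_proj (cay n S)) \<longleftrightarrow> sym (parcs (cay n S))"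
    by (simp add: symmetric_def)
  show ?thesis
  proof
    assume "symmetric (with_proj (cay n S))"
    then have swap: "(y, x) \<in> parcs (cay n S)" if "(x, y) \<in> parcs (cay n S)" for x y
      using that sym by (auto dest: symD)
    have sub: "(\<lambda>s. (n - 1) * s mod n) ` S \<subseteq> S"
    proof
      fix t assume "t \<in> (\<lambda>s. (n - 1) * s mod n) ` S"
      then obtain s where s: "s \<in> S" "t = (n - 1) * s mod n" by auto
      then have "s < n" using assms(2) by auto
      then have "(0, s) \<in> parcs (cay n S)"
        using s assms(1) by (simp add: parcs_cay offset_zero_left)
      then have "(s, 0) \<in> parcs (cay n S)" by (rule swap)
      then show "t \<in> S"
        using offset_swap[OF assms(1), of s 0] s \<open>s < n\<close>
        by (simp add: parcs_cay offset_zero_left)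
    qed
    have "coprime (n - 1) n" using assms(1) coprime_diff_one_left_nat by blast
    then have "inj_on (\<lambda>s. (n - 1) * s mod n) S"
      using assms(2) by (intro inj_on_subset[OF inj_on_mult_mod]) auto
    moreover have "finite S" using assms(2) finite_subset by blast
    ultimately show "mult_set n (n - 1) S = S"
      unfolding mult_set_def using sub by (intro endo_inj_surj)
  next
    assume neg: "mult_set n (n - 1) S = S"
    have "(y, x) \<in> parcs (cay n S)" if "(x, y) \<in> parcs (cay n S)" for x y
    proof -
      have "(n - 1) * offset n x y mod n \<in> mult_set n (n - 1) S"
        using that by (auto simp: parcs_cay mult_set_def)
      then show ?thesis
        using that neg offset_swap[OF assms(1), of y x] by (simp add: parcs_cay)
    qed
    then show "symmetric (with_proj (cay n S))" unfolding sym by (auto intro: symI)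
  qed
qed

lemma digraph_iso_cay_iff:
  assumes "S \<subseteq> {1..<n}"
  shows "digraph_iso (with_proj (cay n S)) (with_proj (cay n S')) \<longleftrightarrow> cay_iso n S S' \<noteq> {}"
  unfolding digraph_iso_with_proj_iff[OF pair_digraph_cay[OF assms]]
proof
  assume "\<exists>f. bij_betw f (pverts (cay n S)) (pverts (cay n S')) \<and>
    map_prod f f ` parcs (cay n S) = parcs (cay n S')"
  then obtain f where f: "bij_betw f {..<n} {..<n}"
      "map_prod f f ` parcs (cay n S) = parcs (cay n S')"
    by (auto simp: pverts_cay atLeast0LessThan)
  define g where "g x = (if x < n then f x else x)" for x
  have "g permutes {..<n}"
  proof (rule bij_imp_permutes)
    show "bij_betw g {..<n} {..<n}"
      using f(1) by (rule bij_betw_cong[THEN iffD1, rotated]) (simp add: g_def)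
  qed (simp add: g_def)
  moreover have "offset n (g x) (g y) \<in> S' \<longleftrightarrow> offset n x y \<in> S" if "x < n" "y < n" for x y
  proof -
    have fx: "f x < n" "f y < n" using f(1) that by (auto simp: bij_betw_def)
    have inj: "inj_on f {..<n}" using f(1) by (simp add: bij_betw_def)
    have "(f x, f y) \<in> map_prod f f ` parcs (cay n S) \<longleftrightarrow> (x, y) \<in> parcs (cay n S)"
    proof
      assume "(f x, f y) \<in> map_prod f f ` parcs (cay n S)"
      then obtain a b where ab: "f x = f a" "f y = f b" "(a, b) \<in> parcs (cay n S)" by auto
      then have "a < n" "b < n" by (auto simp: parcs_cay)
      then have "x = a" "y = b" using ab inj_onD[OF inj] that by auto
      then show "(x, y) \<in> parcs (cay n S)" using ab by simp
    next
      assume "(x, y) \<in> parcs (cay n S)"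
      then show "(f x, f y) \<in> map_prod f f ` parcs (cay n S)" by (auto intro: map_prod_imageI)
    qed
    then show ?thesis unfolding f(2) using fx that by (simp add: parcs_cay g_def)
  qed
  ultimately have "g \<in> cay_iso n S S'" by (simp add: cay_iso_def)
  then show "cay_iso n S S' \<noteq> {}" by blast
next
  assume "cay_iso n S S' \<noteq> {}"
  then obtain f where f: "f \<in> cay_iso n S S'" by blast
  then have p: "f permutes {..<n}"
    and arc: "\<And>x y. x < n \<Longrightarrow> y < n \<Longrightarrow> offset n (f x) (f y) \<in> S' \<longleftrightarrow> offset n x y \<in> S"
    by (auto simp: cay_iso_def)
  have "bij_betw f {..<n} {..<n}" using p by (rule permutes_imp_bij)
  moreover have "map_prod f f ` parcs (cay n S) = parcs (cay n S')"
  proof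
    show "map_prod f f ` parcs (cay n S) \<subseteq> parcs (cay n S')"
      using arc cay_iso_less[OF f] by (auto simp: parcs_cay)
    show "parcs (cay n S') \<subseteq> map_prod f f ` parcs (cay n S)"
    proof (rule subrelI)
      fix x y assume xy: "(x, y) \<in> parcs (cay n S')"
      then have "x \<in> f ` {..<n}" "y \<in> f ` {..<n}"
        using permutes_image[OF p] by (auto simp: parcs_cay)
      then obtain a b where ab: "a < n" "x = f a" "b < n" "y = f b" by auto
      then have "(a, b) \<in> parcs (cay n S)" using xy arc by (simp add: parcs_cay)
      then show "(x, y) \<in> map_prod f f ` parcs (cay n S)"
        unfolding ab by (rule map_prod_imageI)
    qed
  qed
  ultimately show "\<exists>f. bij_betw f (pverts (cay n S)) (pverts (cay n S')) \<and>
      map_prod f f ` parcs (cay n S) = parcs (cay n S')"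
    by (auto simp: pverts_cay atLeast0LessThan)
qed

text \<open>The hypothesis \<open>CI\<close> is the Cayley isomorphism property, restricted to connection sets of equal size.\<close>
lemma C_du_eq_card_mult_classes:
  assumes n: "n > 0"
    and CI: "\<And>S S' f. S \<subseteq> {1..<n} \<Longrightarrow> S' \<subseteq> {1..<n} \<Longrightarrow> card S = card S' \<Longrightarrow>
      f \<in> cay_iso n S S' \<Longrightarrow> \<exists>u. coprime u n \<and> S' = mult_set n u S"
  shows "C_du n r = card (conn_sets n {1..<n} r // mult_rel n (conn_sets n {1..<n} r))"
  unfolding C_du_def
proof (rule card_quotient_bij[where F = "cay n", symmetric])
  let ?A = "conn_sets n {1..<n} r"
  have A: "S \<in> ?A \<longleftrightarrow> S \<subseteq> {1..<n} \<and> cay n S \<in> nonsym_circulants n r" for S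
    using circulant_cay[OF n] regular_cay_iff[OF n] symmetric_cay_iff[OF n]
    by (auto simp: conn_sets_def nonsym_circulants_def)
  show "bij_betw (cay n) ?A (nonsym_circulants n r)"
    unfolding bij_betw_def
  proof
    show "inj_on (cay n) ?A"
      by (rule inj_onI, rule cay_inj[of _ n]) (auto simp: conn_sets_def)
    show "cay n ` ?A = nonsym_circulants n r"
    proof
      show "cay n ` ?A \<subseteq> nonsym_circulants n r" using A by blast
      show "nonsym_circulants n r \<subseteq> cay n ` ?A"
      proof
        fix G assume G: "G \<in> nonsym_circulants n r"
        then have "circulant n G" by (simp add: nonsym_circulants_def)
        then obtain S where "S \<subseteq> {1..<n}" "G = cay n S" using circulant_imp_cay[OF n] by blast
        then show "G \<in> cay n ` ?A" using G A by blast
      qed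
    qed
  qed
  show "mult_rel n ?A \<subseteq> ?A \<times> ?A" by (auto simp: mult_rel_def)
  show "iso_on (nonsym_circulants n r) \<subseteq> nonsym_circulants n r \<times> nonsym_circulants n r"
    by (auto simp: iso_on_def)
  fix S S' assume S: "S \<in> ?A" "S' \<in> ?A"
  then have sub: "S \<subseteq> {1..<n}" "S' \<subseteq> {1..<n}" "card S = card S'"
    by (auto simp: conn_sets_def)
  have "cay_iso n S S' \<noteq> {} \<longleftrightarrow> (\<exists>u. coprime u n \<and> S' = mult_set n u S)"
  proof
    assume "cay_iso n S S' \<noteq> {}"
    then show "\<exists>u. coprime u n \<and> S' = mult_set n u S" using CI[OF sub] by blast
  next
    assume "\<exists>u. coprime u n \<and> S' = mult_set n u S"
    then obtain u where u: "coprime u n" "S' = mult_set n u S" by blast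
    have "S \<subseteq> {..<n}" using sub(1) by auto
    then have "aff n u 0 \<in> cay_iso n S S'"
      using aff_in_intertwiners[OF u(1), of S 0 1] unfolding u(2) intertwiners_def by blast
    then show "cay_iso n S S' \<noteq> {}" by blast
  qed
  then show "(cay n S, cay n S') \<in> iso_on (nonsym_circulants n r) \<longleftrightarrow> (S, S') \<in> mult_rel n ?A"
    using S A digraph_iso_cay_iff[OF sub(1)] by (simp add: iso_on_def mult_rel_def)
qed

section \<open>The identity\<close>

theorem C_du_prime:
  assumes "prime p" "p = 2 * m + 1"
  shows "C_du p r = card (asym_sets m r // shift_rel m UNIV r)"
proof -
  have "\<exists>u. coprime u p \<and> S' = mult_set p u S"
    if "S \<subseteq> {1..<p}" "S' \<subseteq> {1..<p}" "f \<in> cay_iso p S S'" for S S' f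
  proof -
    have "S \<subseteq> {..<p}" "S' \<subseteq> {..<p}" using that by auto
    then show ?thesis using cay_iso_prime[OF assms(1)] that by blast
  qed
  then show ?thesis
    using C_du_eq_card_mult_classes[of p r] card_mult_classes_prime[OF assms, of r]
      prime_gt_0_nat[OF assms(1)] by simp
qed

theorem C_du_double_prime:
  assumes "prime q" "odd q" "m = q - 1"
  shows "C_du (2 * q) r = card (asym_sets m r // shift_rel m {k. even k} r) +
    (case r of 0 \<Rightarrow> 0 | Suc r' \<Rightarrow> card (asym_sets m r' // shift_rel m {k. even k} r'))"
proof -
  have "C_du (2 * q) r = card (conn_sets (2 * q) {1..<2 * q} r //
      mult_rel (2 * q) (conn_sets (2 * q) {1..<2 * q} r))"
    using cay_iso_double_prime[OF assms(1,2) refl] prime_gt_0_nat[OF assms(1)]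
    by (intro C_du_eq_card_mult_classes) auto
  then show ?thesis
    unfolding card_mult_classes_split[OF prime_gt_1_nat[OF assms(1)] refl refl]
      card_mult_classes_double_prime[OF assms(1,2) refl assms(3)] .
qed

theorem mainTheorem5:
  fixes p :: nat
  assumes "prime p" and "odd p"
    and "prime ((p + 1) div 2)" and "odd ((p + 1) div 2)"
  shows "2 * (1 + [:0, 1:]) * c_du p = c_du (p + 1)"
proof (rule poly_eqI)
  fix r
  define q m where "q = (p + 1) div 2" and "m = q - 1"
  have q: "prime q" "odd q" using assms by (simp_all add: q_def)
  have pq: "p + 1 = 2 * q" using assms(2) by (simp add: q_def)
  then have pm: "p = 2 * m + 1" using prime_gt_0_nat[OF q(1)] by (simp add: m_def)
  have half: "card (asym_sets m r // shift_rel m {k. even k} r) = 2 * C_du p r" for r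
    using C_du_prime[OF assms(1) pm] card_even_shift_classes by simp
  have "2 * (1 + [:0, 1:]) * c_du p = 2 * (c_du p + pCons 0 (c_du p))"
    by (simp add: algebra_simps)
  then have "Polynomial.coeff (2 * (1 + [:0, 1:]) * c_du p) r =
      2 * Polynomial.coeff (c_du p + pCons 0 (c_du p)) r"
    by (simp only: mult_2 Polynomial.coeff_add)
  also have "\<dots> = 2 * int (C_du p r) + (case r of 0 \<Rightarrow> 0 | Suc r' \<Rightarrow> 2 * int (C_du p r'))"
    by (cases r) (simp_all add: coeff_c_du)
  also have "\<dots> = int (C_du (p + 1) r)"
    unfolding pq C_du_double_prime[OF q m_def] half by (simp split: nat.split)
  finally show "Polynomial.coeff (2 * (1 + [:0, 1:]) * c_du p) r = Polynomial.coeff (c_du (p + 1)) r"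
    by (simp add: coeff_c_du)
qed

end
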